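(* Let $r,j\in\mathbb{N}$ with $\gcd(r,j)=1$ and let $1\leqslant H\leqslant M\leqslant r$. Then for every $\varepsilon>0$, $$E_2(r,j,M,H)\ll\left(\frac{H^3M^2}{r}+HM\right)r^{\varepsilon}$$ and $$E_4(r,j,M,H)\ll H^2M^2\left(\frac{H^3M^2}{r}+HM\right)r^{\varepsilon},$$ where the implied constants depend only on $\varepsilon$.
   Context: A modular square root of $s$ modulo $r$ is a residue $k$ modulo $r$ with $k^2\equiv s\pmod r$. $E_2(r,j,M,H)$ is the number of tuples $(m_1,m_2,m_3,m_4,k_1,k_2,k_3,k_4)$ where $m_i$ are integers with $1\leqslant m_i\leqslant M$, $k_i$ are residues modulo $r$ with $k_i^2\equiv jm_i\pmod r$, $1\leqslant|m_1-m_2|\leqslant H$, $1\leqslant|m_3-m_4|\leqslant H$, and $k_1-k_2\equiv k_3-k_4\pmod r$. $E_4(r,j,M,H)$ is the number of tuples $(m_1,\dots,m_8,k_1,\dots,k_8)$ where $m_i$ are integers with $1\leqslant m_i\leqslant M$, $k_i$ are residues modulo $r$ with $k_i^2\equiv jm_i\pmod r$, $1\leqslant|m_i-m_{i+1}|\leqslant H$ for $i=1,3,5,7$, and $k_1-k_2+k_3-k_4\equiv k_5-k_6+k_7-k_8\pmod r$. *)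

theory Defs
  imports Complex_Main "HOL-Library.FuncSet" "HOL-Number_Theory.Cong"
begin

text \<open>Residues modulo \<open>r\<close> are represented by the integers in \<open>{0..<r}\<close>.\<close>

definition mod_sqrts :: "nat \<Rightarrow> int \<Rightarrow> int set" where
  "mod_sqrts r s = {k \<in> {0..<int r}. [k\<^sup>2 = s] (mod int r)}"

text \<open>Tuples \<open>(m\<^sub>1, \<dots>, m\<^sub>n, k\<^sub>1, \<dots>, k\<^sub>n)\<close> are pairs of functions with domain \<open>{1..n}\<close>,
  extensional outside it so that distinct tuples are distinct pairs.\<close>

definition sqrt_tuples :: "nat \<Rightarrow> nat \<Rightarrow> nat \<Rightarrow> real \<Rightarrow> ((nat \<Rightarrow> int) \<times> (nat \<Rightarrow> int)) set" where
  "sqrt_tuples n r j M =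
     {(m, k). m \<in> {1..n} \<rightarrow>\<^sub>E {a :: int. 1 \<le> a \<and> real_of_int a \<le> M} \<and>
              k \<in> (\<Pi>\<^sub>E i \<in> {1..n}. mod_sqrts r (int j * m i))}"

definition near_distinct :: "real \<Rightarrow> int \<Rightarrow> int \<Rightarrow> bool" where
  "near_distinct H a b \<longleftrightarrow> 1 \<le> \<bar>a - b\<bar> \<and> real_of_int \<bar>a - b\<bar> \<le> H"

definition E2 :: "nat \<Rightarrow> nat \<Rightarrow> real \<Rightarrow> real \<Rightarrow> nat" where
  "E2 r j M H = card {(m, k) \<in> sqrt_tuples 4 r j M.
     (\<forall>i \<in> {1, 3}. near_distinct H (m i) (m (i + 1))) \<and>
     [k 1 - k 2 = k 3 - k 4] (mod int r)}"

definition E4 :: "nat \<Rightarrow> nat \<Rightarrow> real \<Rightarrow> real \<Rightarrow> nat" where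
  "E4 r j M H = card {(m, k) \<in> sqrt_tuples 8 r j M.
     (\<forall>i \<in> {1, 3, 5, 7}. near_distinct H (m i) (m (i + 1))) \<and>
     [k 1 - k 2 + k 3 - k 4 = k 5 - k 6 + k 7 - k 8] (mod int r)}"

end

theory Submission
  imports Defs "HOL-Analysis.Kronecker_Approximation_Theorem" "HOL-Analysis.Harmonic_Numbers"
    "HOL-Computational_Algebra.Primes"
begin

text \<open>
  Put \<open>d = k\<^sub>1 - k\<^sub>2\<close>, \<open>x = d\<^sup>2 / j\<close>, \<open>h = m\<^sub>1 - m\<^sub>2\<close> and \<open>T = 2 (m\<^sub>1 + m\<^sub>2)\<close>; then
  \<open>h\<^sup>2 - x T + x\<^sup>2 \<equiv> 0\<close> modulo \<open>r\<close>, so \<open>E\<^sub>2\<close> is controlled by the sum over \<open>x\<close> of the squared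
  number of points \<open>(h, T)\<close> on this conic. Dirichlet's theorem yields \<open>a \<equiv> x b\<close> with \<open>b \<le> \<surd>(M r) / H\<close> and
  \<open>\<bar>a\<bar> \<le> 2 H \<surd>(r / M)\<close>. On the conic \<open>b h\<^sup>2 - a T\<close> is constant modulo \<open>r\<close> and hence takes
  \<open>O(1 + H \<surd>(M / r))\<close> values; where it is constant, \<open>a\<close> divides \<open>h\<^sup>2 - h'\<^sup>2\<close> with quotient at most
  \<open>4 M / b\<close>. Splitting \<open>a\<close> between \<open>h - h'\<close> and \<open>h + h'\<close> leaves about \<open>1 + \<surd>(M f\<^sup>2 / (\<bar>a\<bar> b))\<close> values of \<open>h\<close>
  for some \<open>f \<le> 2 H\<close> with \<open>f\<^sup>2\<close> dividing \<open>a\<close>, and \<open>M f\<^sup>2 / (\<bar>a\<bar> b)\<close> summed over \<open>f\<close>, \<open>a\<close>, \<open>b\<close> is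
  \<open>H M\<close> up to logarithms.

  A point \<open>(h, T)\<close> comes from few pairs \<open>(k\<^sub>1, k\<^sub>2)\<close> when no prime \<open>p\<close> with \<open>p\<^sup>2\<close> dividing \<open>r\<close> divides both
  \<open>k\<^sub>i\<close>. In general let \<open>g\<close> be maximal such that \<open>g\<^sup>2\<close> divides \<open>r\<close> and \<open>g\<close> divides \<open>k\<^sub>1\<close> and \<open>k\<^sub>2\<close>; dividing
  the roots by \<open>g\<close> replaces \<open>r\<close>, \<open>M\<close>, \<open>H\<close> by their quotients by \<open>g\<^sup>2\<close>, and each reduced pair arises from at
  most \<open>g\<^sup>2\<close> pairs, a loss of \<open>g\<^sup>4\<close> that the gain in \<open>H M\<close> absorbs.

  The bound for \<open>E\<^sub>4\<close> follows from that for \<open>E\<^sub>2\<close> by fixing two of the four pairs and applying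
  the Cauchy--Schwarz inequality to the other two.
\<close>

section \<open>Divisor bound\<close>

definition ndiv :: "int \<Rightarrow> nat" where
  "ndiv n = card {d. 0 < d \<and> d dvd n}"

lemma finite_pos_divisors [simp]: "n \<noteq> 0 \<Longrightarrow> finite {d::int. 0 < d \<and> d dvd n}"
  by (rule finite_subset[of _ "{0..\<bar>n\<bar>}"]) (auto dest: dvd_imp_le_int)

lemma ndiv_pos: "n \<noteq> 0 \<Longrightarrow> 1 \<le> ndiv n"
  unfolding ndiv_def Suc_le_eq One_nat_def by (subst card_gt_0_iff) (auto intro: exI[of _ 1])

text \<open>A divisor of the product splits into a power of \<open>p\<close> with exponent at most
  \<open>e\<close> and a divisor of \<open>n\<close>. The prime \<open>p\<close> may divide
  \<open>n\<close>, so the splitting need not be unique and only an inequality results.\<close>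

lemma ndiv_prime_power_mult_le:
  fixes p n :: int
  assumes p: "prime p" and n: "n > 0"
  shows "ndiv (p ^ e * n) \<le> (e + 1) * ndiv n"
proof -
  have "{d. 0 < d \<and> d dvd p ^ e * n} \<subseteq> (\<lambda>(i, d). p ^ i * d) ` ({..e} \<times> {d. 0 < d \<and> d dvd n})"
  proof
    fix d assume "d \<in> {d. 0 < d \<and> d dvd p ^ e * n}"
    then have d: "0 < d" "d dvd p ^ e * n" by auto
    obtain u v where uv: "d = u * v" "u dvd p ^ e" "v dvd n"
      using division_decomp[OF d(2)] by blast
    obtain i where i: "i \<le> e" "normalize u = p ^ i"
      using uv(2) p by (metis divides_primepow_weak normalize_prime normalize_power)
    have "\<bar>u\<bar> = p ^ i" using i by simp
    moreover have "d = \<bar>u\<bar> * \<bar>v\<bar>" using d uv(1) by (simp flip: abs_mult)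
    moreover have "0 < \<bar>v\<bar>" using uv n by auto
    ultimately show "d \<in> (\<lambda>(i, d). p ^ i * d) ` ({..e} \<times> {d. 0 < d \<and> d dvd n})"
      using i uv(3) by (intro image_eqI[of _ _ "(i, \<bar>v\<bar>)"]) auto
  qed
  then have "ndiv (p ^ e * n) \<le> card ((\<lambda>(i, d). p ^ i * d) ` ({..e} \<times> {d. 0 < d \<and> d dvd n}))"
    unfolding ndiv_def using n by (intro card_mono) auto
  also have "\<dots> \<le> card ({..e} \<times> {d. 0 < d \<and> d dvd n})"
    using n by (intro card_image_le) auto
  finally show ?thesis by (simp add: ndiv_def card_cartesian_product)
qed

text \<open>Exponential growth beats linear growth. The left side is the factor that
  \<open>p ^ e\<close> adds to the divisor count, and \<open>2 powr (e * \<delta>)\<close> is the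
  least that it adds to \<open>n powr \<delta>\<close>, so \<open>c\<close> is the price of one
  small prime.\<close>

lemma Suc_le_powr_growth:
  fixes \<delta> :: real
  assumes "\<delta> > 0"
  shows "\<exists>c\<ge>1. \<forall>e::nat. real e + 1 \<le> c * 2 powr (e * \<delta>)"
proof -
  have "1 + real e \<le> (1 + 1 / (\<delta> * ln 2)) * 2 powr (e * \<delta>)" for e :: nat
  proof -
    have 1: "1 + e * \<delta> * ln 2 \<le> 2 powr (e * \<delta>)"
      using exp_ge_add_one_self[of "e * \<delta> * ln 2"] by (simp add: powr_def)
    have 2: "1 \<le> 2 powr (e * \<delta>)" using assms by (simp add: ge_one_powr_ge_zero)
    have "real e = (e * \<delta> * ln 2) * (1 / (\<delta> * ln 2))" using assms by (simp add: field_simps)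
    also have "\<dots> \<le> 2 powr (e * \<delta>) * (1 / (\<delta> * ln 2))"
      using 1 assms by (intro mult_right_mono) auto
    finally show ?thesis using 2 by (simp add: algebra_simps)
  qed
  moreover have "1 + 1 / (\<delta> * ln 2) \<ge> 1" using assms by simp
  ultimately show ?thesis by (metis add.commute)
qed

text \<open>A prime with \<open>p powr \<delta> \<ge> 2\<close> costs nothing, as
  \<open>e + 1 \<le> 2 ^ e\<close>. Only primes below \<open>Q\<close> cost a factor
  \<open>c\<close> each, and \<open>U\<close> bounds their number independently of
  \<open>n\<close>.\<close>

theorem ndiv_bound:
  fixes \<delta> :: real
  assumes \<delta>: "\<delta> > 0"
  shows "\<exists>C\<ge>1. \<forall>n>0. real (ndiv n) \<le> C * real_of_int n powr \<delta>"
proof -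
  obtain c where c: "c \<ge> 1" "\<And>e::nat. real e + 1 \<le> c * 2 powr (e * \<delta>)"
    using Suc_le_powr_growth[OF \<delta>] by blast
  define Q where "Q = 2 powr (1 / \<delta>)"
  define S where "S n = {p::int. prime p \<and> real_of_int p < Q \<and> p dvd n}" for n
  define U where "U = {p::int. 0 < p \<and> real_of_int p < Q}"
  have finU: "finite U"
    unfolding U_def by (rule finite_subset[of _ "{0..\<lceil>Q\<rceil>}"]) (auto simp: le_ceiling_iff)
  have SU: "S n \<subseteq> U" for n unfolding S_def U_def by (auto dest: prime_gt_0_int)
  \<comment> \<open>Strong induction splits off the full power of one prime at a time. The cofactor
    \<open>n'\<close> is prime to it, so a small prime leaves \<open>S n\<close> and is paid for
    only once.\<close>
  have main: "real (ndiv n) \<le> c ^ card (S n) * real_of_int n powr \<delta>" if "n > 0" for n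
    using that
  proof (induction "nat n" arbitrary: n rule: less_induct)
    case less
    show ?case
    proof (cases "n = 1")
      case True
      have "{d::int. 0 < d \<and> d dvd 1} = {1}" by auto
      then show ?thesis using True c(1) by (simp add: ndiv_def)
    next
      case False
      then obtain p where p: "prime p" "p dvd n"
        using less.prems prime_factor_int[of n] by auto
      have p2: "p \<ge> 2" using p prime_ge_2_int by blast
      define e where "e = multiplicity p n"
      obtain n' where n': "n = p ^ e * n'" "\<not> p dvd n'"
        using multiplicity_decompose'[of n p] p less.prems unfolding e_def
        by (metis less_irrefl not_prime_unit prime_def)
      have "e > 0" unfolding e_def using p less.prems
        by (metis less_irrefl not_prime_unit prime_multiplicity_gt_zero_iff prime_imp_prime_elem)
      have n'0: "n' > 0" using n' less.prems p2 by (simp add: zero_less_mult_iff)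
      have "p ^ e \<ge> 2" using one_less_power[of p e] p2 \<open>e > 0\<close> by linarith
      then have "n' < n" using n'(1) n'0 by (smt (verit) mult_le_cancel_right1 mult_less_cancel_right1)
      then have IH: "real (ndiv n') \<le> c ^ card (S n') * real_of_int n' powr \<delta>"
        using less.hyps[of n'] n'0 by auto
      have pe: "real_of_int (p ^ e) powr \<delta> = real_of_int p powr (e * \<delta>)"
        using p2 by (simp add: powr_realpow[symmetric] powr_powr)
      have npow: "real_of_int n powr \<delta> = real_of_int p powr (e * \<delta>) * real_of_int n' powr \<delta>"
        using n' n'0 p2 pe by (simp add: powr_mult)
      have nd: "real (ndiv n) \<le> (real e + 1) * real (ndiv n')"
        using ndiv_prime_power_mult_le[OF p(1) n'0, of e] n'(1)
        by (metis (no_types, lifting) of_nat_1 of_nat_add of_nat_le_iff of_nat_mult)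
      have sub: "S n' \<subseteq> S n" using n' by (auto simp: S_def)
      show ?thesis
      proof (cases "real_of_int p < Q")
        case True
        have "p \<in> S n" "p \<notin> S n'" using p True n' by (auto simp: S_def)
        then have "insert p (S n') \<subseteq> S n" using sub by auto
        then have "card (insert p (S n')) \<le> card (S n)"
          using SU finU by (intro card_mono) (auto intro: finite_subset)
        then have cs: "card (S n') + 1 \<le> card (S n)"
          using \<open>p \<notin> S n'\<close> SU finU by (metis Suc_eq_plus1 card_insert_disjoint finite_subset)
        have "real e + 1 \<le> c * real_of_int p powr (e * \<delta>)"
        proof -
          have "2 powr (e * \<delta>) \<le> real_of_int p powr (e * \<delta>)"
            using p2 \<delta> by (intro powr_mono2) auto
          then have "c * 2 powr (e * \<delta>) \<le> c * real_of_int p powr (e * \<delta>)"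
            using c(1) by (intro mult_left_mono) auto
          then show ?thesis using c(2)[of e] by linarith
        qed
        then have "(real e + 1) * real (ndiv n') \<le> (c * real_of_int p powr (e * \<delta>)) * (c ^ card (S n') * real_of_int n' powr \<delta>)"
          using IH c(1) by (intro mult_mono) auto
        also have "\<dots> = c ^ (card (S n') + 1) * real_of_int n powr \<delta>" by (simp add: npow)
        also have "\<dots> \<le> c ^ card (S n) * real_of_int n powr \<delta>"
          using cs c(1) by (intro mult_right_mono power_increasing) auto
        finally show ?thesis using nd by linarith
      next
        case False
        have "2 = Q powr \<delta>" using \<delta> by (simp add: Q_def powr_powr)
        also have "\<dots> \<le> real_of_int p powr \<delta>" using False \<delta> by (intro powr_mono2) (auto simp: Q_def)
        finally have "2 ^ e \<le> (real_of_int p powr \<delta>) ^ e" by (intro power_mono) auto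
        also have "\<dots> = real_of_int p powr (e * \<delta>)"
          using p2 by (simp add: powr_realpow[symmetric] powr_powr mult.commute)
        finally have e2: "2 ^ e \<le> real_of_int p powr (e * \<delta>)" .
        have "real (e + 1) \<le> real (2 ^ e)"
          unfolding of_nat_le_iff using less_exp[of e] by linarith
        then have "(real e + 1) * real (ndiv n') \<le> real_of_int p powr (e * \<delta>) * (c ^ card (S n') * real_of_int n' powr \<delta>)"
          using IH c(1) e2 by (intro mult_mono) auto
        also have "\<dots> = c ^ card (S n') * real_of_int n powr \<delta>" by (simp add: npow)
        also have "\<dots> \<le> c ^ card (S n) * real_of_int n powr \<delta>"
          using sub SU finU c(1) by (intro mult_right_mono power_increasing card_mono) (auto intro: finite_subset)
        finally show ?thesis using nd by linarith
      qed
    qed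
  qed
  show ?thesis
  proof (intro exI[of _ "c ^ card U"] conjI allI impI)
    show "1 \<le> c ^ card U" using c by simp
    fix n :: int assume "n > 0"
    have "c ^ card (S n) * real_of_int n powr \<delta> \<le> c ^ card U * real_of_int n powr \<delta>"
      using SU finU c(1) by (intro mult_right_mono power_increasing card_mono) auto
    then show "real (ndiv n) \<le> c ^ card U * real_of_int n powr \<delta>"
      using main[OF \<open>n > 0\<close>] by linarith
  qed
qed

section \<open>Square roots modulo an integer\<close>

lemma card_eq_sum_fibers:
  assumes "finite A" "finite B" "g ` A \<subseteq> B"
  shows "card A = (\<Sum>b\<in>B. card {x\<in>A. g x = b})"
  using sum.group[OF assms, of "\<lambda>_. 1 :: nat"] by simp

lemma card_le_fibers:
  fixes W :: real
  assumes "finite A" "finite B" "g ` A \<subseteq> B" "\<And>b. b \<in> B \<Longrightarrow> real (card {x\<in>A. g x = b}) \<le> W"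
  shows "real (card A) \<le> real (card B) * W"
  using card_eq_sum_fibers[OF assms(1-3)] sum_bounded_above[of B "\<lambda>b. real (card {x\<in>A. g x = b})" W] assms(4)
  by simp

text \<open>Subtracting the minimum and dividing by \<open>q\<close> sends \<open>A\<close>
  injectively into the integers from 0 to \<open>Y / q\<close>.\<close>

lemma card_spaced_le:
  fixes A :: "int set" and Y :: real
  assumes "finite A" "q > 0" "Y \<ge> 0"
    and dv: "\<And>x y. x \<in> A \<Longrightarrow> y \<in> A \<Longrightarrow> q dvd x - y"
    and Y: "\<And>x y. x \<in> A \<Longrightarrow> y \<in> A \<Longrightarrow> real_of_int \<bar>x - y\<bar> \<le> Y"
  shows "real (card A) \<le> 1 + Y / q"
proof (cases "A = {}")
  case True
  then show ?thesis using assms by simp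
next
  case False
  define a where "a = Min A"
  have a: "a \<in> A" "\<And>x. x \<in> A \<Longrightarrow> a \<le> x" using False assms(1) by (auto simp: a_def)
  have inj: "inj_on (\<lambda>x. (x - a) div q) A"
    by (rule inj_onI) (metis a(1) dv dvd_div_mult_self diff_add_cancel)
  have "(\<lambda>x. (x - a) div q) ` A \<subseteq> {0..\<lfloor>Y / q\<rfloor>}"
  proof (clarsimp, intro conjI)
    fix x assume x: "x \<in> A"
    show "0 \<le> (x - a) div q" using a(2)[OF x] assms(2) by (simp add: pos_imp_zdiv_nonneg_iff)
    have "real_of_int ((x - a) div q) = real_of_int (x - a) / q"
      using dv[OF x a(1)] by (simp add: real_of_int_div)
    also have "\<dots> \<le> Y / q" using Y[OF x a(1)] assms(2) by (intro divide_right_mono) auto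
    finally show "(x - a) div q \<le> \<lfloor>Y / q\<rfloor>" by (simp add: le_floor_iff)
  qed
  then have "card A \<le> card {0..\<lfloor>Y / q\<rfloor>}"
    by (intro card_inj_on_le[OF inj]) simp_all
  also have "real \<dots> = 1 + \<lfloor>Y / q\<rfloor>" using assms by simp
  also have "\<dots> \<le> 1 + Y / q" by simp
  finally show ?thesis by simp
qed

text \<open>For positive \<open>r\<close> and a divisor \<open>u\<close>, this is the factor by
  which the lcm of the complementary divisors \<open>u\<close> and \<open>r div u\<close> falls
  short of \<open>r\<close>. It measures the ambiguity left when a residue modulo \<open>r\<close>
  is known modulo both.\<close>

definition overlap :: "int \<Rightarrow> int \<Rightarrow> int" where
  "overlap r u = gcd u (r div u)"

lemma overlap_props:
  fixes r u :: int
  assumes "r > 0" "u dvd r"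
  shows "overlap r u > 0" "overlap r u dvd u" "overlap r u dvd r" "(overlap r u)\<^sup>2 dvd r"
proof -
  have r: "r = u * (r div u)" using assms by simp
  have u0: "u \<noteq> 0" using assms by auto
  show "overlap r u > 0" using u0 by (simp add: overlap_def)
  show 1: "overlap r u dvd u" by (simp add: overlap_def)
  then show "overlap r u dvd r" using assms(2) dvd_trans by blast
  have "overlap r u * overlap r u dvd u * (r div u)" unfolding overlap_def by (intro mult_dvd_mono) auto
  then show "(overlap r u)\<^sup>2 dvd r" using r by (simp add: power2_eq_square)
qed

text \<open>The modulus divides \<open>(k - k0) * (k + k0)\<close>. Once its common factor with
  \<open>k - k0\<close> is removed, what remains of \<open>r\<close> is coprime to what remains of
  \<open>k - k0\<close> and must divide the other factor.\<close>

lemma cofactor_dvd_add: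
  fixes r k k0 :: int
  assumes "r > 0" "r dvd k\<^sup>2 - k0\<^sup>2"
  shows "r div gcd r (k - k0) dvd k + k0"
proof -
  let ?u = "gcd r (k - k0)"
  have u0: "?u \<noteq> 0" using assms by auto
  have "coprime (r div ?u) ((k - k0) div ?u)"
    using assms(1) by (intro div_gcd_coprime) auto
  moreover have "?u * (r div ?u) dvd ?u * (((k - k0) div ?u) * (k + k0))"
  proof -
    have "?u * (r div ?u) = r" by simp
    moreover have "?u * (((k - k0) div ?u) * (k + k0)) = (k - k0) * (k + k0)"
      by (metis dvd_div_mult_self gcd_dvd2 mult.assoc mult.commute)
    ultimately show ?thesis using assms(2) by (simp add: power2_eq_square algebra_simps)
  qed
  ultimately show ?thesis
    using u0 by (metis coprime_dvd_mult_right_iff dvd_mult_cancel_left)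
qed

text \<open>Both roots are congruent to \<open>k0\<close> modulo \<open>u\<close> and to
  \<open>- k0\<close> modulo \<open>r div u\<close>. Hence they agree modulo the lcm of these
  divisors, and \<open>overlap r u\<close> times that lcm is \<open>r\<close>.\<close>

lemma same_gcd_dvd:
  fixes r k k' k0 :: int
  assumes r: "r > 0" and k: "r dvd k\<^sup>2 - k0\<^sup>2" "gcd r (k - k0) = u"
    and k': "r dvd k'\<^sup>2 - k0\<^sup>2" "gcd r (k' - k0) = u"
  shows "r dvd overlap r u * (k - k')"
proof -
  have ur: "u dvd r" using k(2) by auto
  have "u dvd k - k0" "u dvd k' - k0" by (metis k(2) gcd_dvd2, metis k'(2) gcd_dvd2)
  then have 1: "u dvd k - k'" by (metis diff_diff_eq2 diff_add_cancel dvd_diff)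
  have "r div u dvd k + k0" "r div u dvd k' + k0"
    using cofactor_dvd_add[OF r k(1)] cofactor_dvd_add[OF r k'(1)] k(2) k'(2) by simp_all
  then have 2: "r div u dvd k - k'" by (metis add_diff_cancel_right dvd_diff)
  have "lcm u (r div u) dvd k - k'" using 1 2 by simp
  then have "gcd u (r div u) * lcm u (r div u) dvd gcd u (r div u) * (k - k')" by (intro mult_dvd_mono) auto
  moreover have "gcd u (r div u) * lcm u (r div u) = \<bar>u * (r div u)\<bar>"
    by (simp add: prod_gcd_lcm_int[symmetric] abs_mult)
  ultimately show ?thesis using ur by (simp add: overlap_def)
qed

text \<open>The overlap divides both \<open>k - k0\<close> and \<open>k + k0\<close>, hence their
  sum and difference. This ties the size of a class of roots to the divisibility of the roots
  themselves.\<close>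

lemma overlap_dvd_twice:
  fixes r k k0 :: int
  assumes "r > 0" "r dvd k\<^sup>2 - k0\<^sup>2" "gcd r (k - k0) = u"
  shows "overlap r u dvd 2 * k" "overlap r u dvd 2 * k0"
proof -
  have 1: "overlap r u dvd k - k0" by (metis assms(3) gcd_dvd1 gcd_dvd2 dvd_trans overlap_def)
  have 2: "overlap r u dvd k + k0" using cofactor_dvd_add[OF assms(1,2)] assms(3)
    by (metis gcd_dvd2 dvd_trans overlap_def)
  show "overlap r u dvd 2 * k" using dvd_add[OF 1 2] by (simp add: algebra_simps)
  show "overlap r u dvd 2 * k0" using dvd_diff[OF 2 1] by (simp add: algebra_simps)
qed

definition sqroots :: "int \<Rightarrow> int \<Rightarrow> int set" where
  "sqroots r c = {k \<in> {0..<r}. r dvd k\<^sup>2 - c}"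

lemma finite_sqroots [simp]: "finite (sqroots r c)"
  unfolding sqroots_def by (rule finite_subset[of _ "{0..<r}"]) auto

lemma card_spaced_residues_le:
  fixes A :: "int set"
  assumes "A \<subseteq> {0..<r}" "f > 0" "f dvd r" and dv: "\<And>x y. x \<in> A \<Longrightarrow> y \<in> A \<Longrightarrow> r dvd f * (x - y)"
  shows "int (card A) \<le> f"
proof (cases "A = {}")
  case False
  then have r: "r > 0" using assms(1) by (metis atLeastLessThan_empty_iff subset_empty not_le less_imp_le linorder_not_less)
  have fin: "finite A" using assms(1) finite_subset by blast
  obtain q where q: "r = f * q" using assms(3) by blast
  have q0: "q > 0" using q r assms(2) by (simp add: zero_less_mult_iff)
  \<comment> \<open>Two elements differ by at most \<open>r - 1\<close>. With this instead of
    \<open>r\<close> the final bound is strictly below \<open>1 + f\<close>, so the integer count is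
    at most \<open>f\<close>.\<close>
  have "real (card A) \<le> 1 + (r - 1) / q"
  proof (rule card_spaced_le[OF fin q0])
    show "0 \<le> real_of_int (r - 1)" using r by simp
    show "q dvd x - y" if "x \<in> A" "y \<in> A" for x y using dv[OF that] q assms(2) by simp
    show "real_of_int \<bar>x - y\<bar> \<le> real_of_int (r - 1)" if "x \<in> A" "y \<in> A" for x y
    proof -
      have "x \<in> {0..<r}" "y \<in> {0..<r}" using that assms(1) by blast+
      then show ?thesis by auto
    qed
  qed
  also have "\<dots> < 1 + f" using q q0 r by (simp add: field_simps)
  finally show ?thesis by linarith
qed (use assms in auto)

text \<open>Comparison with one root \<open>k0\<close> sorts the roots by
  \<open>gcd r (k - k0)\<close>, and a class has at most \<open>f = overlap r u\<close> members.
  Since \<open>f\<close> divides \<open>2 * k0\<close> and \<open>f\<^sup>2\<close> divides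
  \<open>r\<close>, also \<open>f\<^sup>2\<close> divides \<open>4 * c\<close>; the sum over all
  such \<open>f\<close> therefore bounds the square of every class size.\<close>

lemma card_sqroots_sq_le:
  assumes r: "r > 0"
  shows "(real (card (sqroots r c)))\<^sup>2 \<le> (real (ndiv r))\<^sup>2 * (\<Sum>f | 0 < f \<and> f dvd r \<and> f\<^sup>2 dvd 4 * c. (real_of_int f)\<^sup>2)"
    (is "_ \<le> _ * ?S")
proof (cases "sqroots r c = {}")
  case True
  then show ?thesis by (simp add: sum_nonneg)
next
  case False
  then obtain k0 where k0: "k0 \<in> sqroots r c" by blast
  have sq: "r dvd k\<^sup>2 - k0\<^sup>2" if "k \<in> sqroots r c" for k
    using that k0 dvd_diff[of r "k\<^sup>2 - c" "k0\<^sup>2 - c"] by (simp add: sqroots_def)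
  let ?D = "{d. 0 < d \<and> d dvd r}"
  have fin: "finite ?D" using r by simp
  have "real (card (sqroots r c)) \<le> real (card ?D) * sqrt ?S"
  proof (rule card_le_fibers[where g = "\<lambda>k. gcd r (k - k0)"])
    fix u assume u: "u \<in> ?D"
    let ?A = "{k \<in> sqroots r c. gcd r (k - k0) = u}"
    show "real (card ?A) \<le> sqrt ?S"
    proof (cases "?A = {}")
      case True
      then show ?thesis by (simp only: True card.empty) (simp add: sum_nonneg)
    next
      case False
      then obtain k where k: "k \<in> sqroots r c" "gcd r (k - k0) = u" by blast
      let ?f = "overlap r u"
      have f: "?f > 0" "?f dvd r" "?f\<^sup>2 dvd r" using overlap_props[OF r] u by auto
      have "?f\<^sup>2 dvd (2 * k0)\<^sup>2" using overlap_dvd_twice(2)[OF r sq[OF k(1)] k(2)] by (rule dvd_power_same)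
      moreover have "?f\<^sup>2 dvd 4 * (k0\<^sup>2 - c)" using f(3) k0 unfolding sqroots_def
        by (metis (no_types, lifting) dvd_mult dvd_trans mem_Collect_eq)
      ultimately have "?f\<^sup>2 dvd (2 * k0)\<^sup>2 - 4 * (k0\<^sup>2 - c)" by (rule dvd_diff)
      then have "?f\<^sup>2 dvd 4 * c" by (simp add: power_mult_distrib algebra_simps)
      then have mem: "?f \<in> {f. 0 < f \<and> f dvd r \<and> f\<^sup>2 dvd 4 * c}" using f by auto
      have "int (card ?A) \<le> ?f"
      proof (rule card_spaced_residues_le[where r = r])
        show "?A \<subseteq> {0..<r}" by (auto simp: sqroots_def)
        show "r dvd ?f * (x - y)" if "x \<in> ?A" "y \<in> ?A" for x y
          using that same_gcd_dvd[OF r, of x k0 u y] sq by blast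
      qed (use f in auto)
      then have "(real (card ?A))\<^sup>2 \<le> (real_of_int ?f)\<^sup>2" by (intro power_mono) (simp_all add: of_int_le_iff[symmetric, where 'a = real] del: of_int_le_iff)
      also have "\<dots> \<le> ?S"
        using mem by (intro member_le_sum[where f = "\<lambda>f. (real_of_int f)\<^sup>2"] finite_subset[OF _ fin]) auto
      finally show ?thesis by (rule real_le_rsqrt)
    qed
  next
    show "(\<lambda>k. gcd r (k - k0)) ` sqroots r c \<subseteq> ?D" using r by (intro image_subsetI) simp
  qed (use fin in simp_all)
  then have "(real (card (sqroots r c)))\<^sup>2 \<le> (real (card ?D) * sqrt ?S)\<^sup>2" by (intro power_mono) auto
  then show ?thesis by (simp add: power_mult_distrib ndiv_def sum_nonneg)
qed

text \<open>Division of \<open>4 * m\<close> by \<open>q\<close> injects the set into the integers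
  from 1 to \<open>4 * X / q\<close>. Positivity of \<open>m\<close> avoids an additive 1, which
  would be too costly when \<open>q\<close> is large compared with \<open>X\<close>.\<close>

lemma card_multiples_le:
  fixes q :: int and X :: real
  assumes "q > 0" "X \<ge> 0"
  shows "real (card {m \<in> {1..\<lfloor>X\<rfloor>}. q dvd 4 * m}) \<le> 4 * X / q"
proof -
  let ?A = "{m \<in> {1..\<lfloor>X\<rfloor>}. q dvd 4 * m}"
  have inj: "inj_on (\<lambda>m. 4 * m div q) ?A"
  proof (rule inj_onI)
    fix x y assume "x \<in> ?A" "y \<in> ?A" "4 * x div q = 4 * y div q"
    then have "4 * x = 4 * y" by (metis (no_types, lifting) dvd_div_mult_self mem_Collect_eq)
    then show "x = y" by simp
  qed
  have "(\<lambda>m. 4 * m div q) ` ?A \<subseteq> {1..\<lfloor>4 * X / q\<rfloor>}"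
  proof (clarsimp, intro conjI)
    fix m assume m: "1 \<le> m" "m \<le> \<lfloor>X\<rfloor>" "q dvd 4 * m"
    have "4 * m div q \<noteq> 0" using m assms(1) by (metis dvd_div_eq_0_iff mult_eq_0_iff not_one_le_zero zero_neq_numeral)
    moreover have "4 * m div q \<ge> 0" using m assms(1) by (simp add: pos_imp_zdiv_nonneg_iff)
    ultimately show "1 \<le> 4 * m div q" by linarith
    have "real_of_int (4 * m div q) = real_of_int (4 * m) / q" using m(3) by (rule real_of_int_div)
    also have "\<dots> \<le> 4 * X / q" using m(2) assms(1) by (intro divide_right_mono) (auto simp: le_floor_iff)
    finally show "4 * m div q \<le> \<lfloor>4 * X / q\<rfloor>" by (simp add: le_floor_iff)
  qed
  then have "card ?A \<le> card {1..\<lfloor>4 * X / q\<rfloor>}"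
    by (intro card_inj_on_le[OF inj]) simp_all
  also have "int \<dots> = \<lfloor>4 * X / q\<rfloor>" using assms by simp
  finally show ?thesis by linarith
qed

text \<open>A radicand has few roots in mean square. After the sums are exchanged, the weight
  \<open>f\<^sup>2\<close> is cancelled by the density at most \<open>4 / f\<^sup>2\<close> of the
  admissible \<open>m\<close>, so each divisor \<open>f\<close> of \<open>r\<close> contributes at
  most \<open>4 * M\<close>.\<close>

lemma sum_card_sqroots_sq_le:
  fixes r j :: int and M :: real
  assumes r: "r > 0" and j: "coprime r j" and M: "M \<ge> 0"
  shows "(\<Sum>m\<in>{1..\<lfloor>M\<rfloor>}. (real (card (sqroots r (j * m))))\<^sup>2) \<le> 4 * M * (real (ndiv r)) ^ 3"
proof -
  let ?D = "{d. 0 < d \<and> d dvd r}" and ?I = "{1..\<lfloor>M\<rfloor>}"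
  have fin: "finite ?D" using r by simp
  have eq: "{f. 0 < f \<and> f dvd r \<and> f\<^sup>2 dvd 4 * (j * m)} = {f \<in> ?D. f\<^sup>2 dvd 4 * m}" for m
  proof -
    have "f\<^sup>2 dvd 4 * (j * m) \<longleftrightarrow> f\<^sup>2 dvd 4 * m" if "f dvd r" for f
    proof -
      have "coprime (f\<^sup>2) j" using that j by (meson coprime_divisors coprime_power_left_iff dvd_refl)
      then show ?thesis by (metis coprime_dvd_mult_right_iff mult.left_commute)
    qed
    then show ?thesis by auto
  qed
  have "(\<Sum>m\<in>?I. (real (card (sqroots r (j * m))))\<^sup>2)
        \<le> (\<Sum>m\<in>?I. (real (ndiv r))\<^sup>2 * (\<Sum>f\<in>{f \<in> ?D. f\<^sup>2 dvd 4 * m}. (real_of_int f)\<^sup>2))"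
  proof (rule sum_mono)
    fix m
    show "(real (card (sqroots r (j * m))))\<^sup>2 \<le> (real (ndiv r))\<^sup>2 * (\<Sum>f\<in>{f \<in> ?D. f\<^sup>2 dvd 4 * m}. (real_of_int f)\<^sup>2)"
      using card_sqroots_sq_le[OF r, of "j * m"] unfolding eq .
  qed
  also have "\<dots> = (real (ndiv r))\<^sup>2 * (\<Sum>m\<in>?I. \<Sum>f\<in>?D. if f\<^sup>2 dvd 4 * m then (real_of_int f)\<^sup>2 else 0)"
    unfolding sum_distrib_left[symmetric] sum.inter_filter[OF fin] ..
  also have "(\<Sum>m\<in>?I. \<Sum>f\<in>?D. if f\<^sup>2 dvd 4 * m then (real_of_int f)\<^sup>2 else 0)
           = (\<Sum>f\<in>?D. \<Sum>m\<in>?I. if f\<^sup>2 dvd 4 * m then (real_of_int f)\<^sup>2 else 0)"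
    by (rule sum.swap)
  also have "\<dots> = (\<Sum>f\<in>?D. real (card {m \<in> ?I. f\<^sup>2 dvd 4 * m}) * (real_of_int f)\<^sup>2)"
    by (intro sum.cong) (simp_all flip: sum.inter_filter)
  also have "\<dots> \<le> (\<Sum>f\<in>?D. 4 * M)"
  proof (intro sum_mono)
    fix f assume "f \<in> ?D"
    then have f: "f\<^sup>2 > 0" by auto
    then show "real (card {m \<in> ?I. f\<^sup>2 dvd 4 * m}) * (real_of_int f)\<^sup>2 \<le> 4 * M"
      using card_multiples_le[OF f M] by (simp add: field_simps)
  qed
  also have "\<dots> = real (ndiv r) * (4 * M)" by (simp add: ndiv_def)
  finally have "(\<Sum>m\<in>?I. (real (card (sqroots r (j * m))))\<^sup>2) \<le> (real (ndiv r))\<^sup>2 * (real (ndiv r) * (4 * M))"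
    by (simp add: mult_left_mono)
  then show ?thesis by (simp add: power2_eq_square power3_eq_cube mult_ac)
qed

section \<open>Counting pairs of roots with nearby radicands\<close>

definition sqroot_pairs :: "int \<Rightarrow> int \<Rightarrow> real \<Rightarrow> real \<Rightarrow> (int \<times> int \<times> int \<times> int) set" where
  "sqroot_pairs r j M H = {(m1, m2, k1, k2). m1 \<in> {1..\<lfloor>M\<rfloor>} \<and> m2 \<in> {1..\<lfloor>M\<rfloor>} \<and>
     near_distinct H m1 m2 \<and> k1 \<in> sqroots r (j * m1) \<and> k2 \<in> sqroots r (j * m2)}"

definition near_pairs :: "real \<Rightarrow> real \<Rightarrow> (int \<times> int) set" where
  "near_pairs M H = (SIGMA m1:{1..\<lfloor>M\<rfloor>}. {m2 \<in> {1..\<lfloor>M\<rfloor>}. near_distinct H m1 m2})"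

lemma sqroot_pairs_Sigma:
  "sqroot_pairs r j M H = (\<lambda>((m1, m2), k1, k2). (m1, m2, k1, k2)) `
     (SIGMA p:near_pairs M H. sqroots r (j * fst p) \<times> sqroots r (j * snd p))" (is "_ = ?g ` ?R")
proof (rule subset_antisym)
  show "sqroot_pairs r j M H \<subseteq> ?g ` ?R"
  proof
    fix x :: "int \<times> int \<times> int \<times> int"
    obtain m1 m2 k1 k2 where x: "x = (m1, m2, k1, k2)" by (rule prod_cases4)
    assume "x \<in> sqroot_pairs r j M H"
    then have "((m1, m2), k1, k2) \<in> ?R" by (simp add: x sqroot_pairs_def near_pairs_def)
    then show "x \<in> ?g ` ?R" unfolding x by (intro image_eqI[of _ _ "((m1, m2), k1, k2)"]) simp_all
  qed
  show "?g ` ?R \<subseteq> sqroot_pairs r j M H"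
    by (rule image_subsetI) (clarsimp simp: sqroot_pairs_def near_pairs_def)
qed

lemma finite_near_pairs: "finite (near_pairs M H)"
  unfolding near_pairs_def by (intro finite_SigmaI finite_Collect_conjI) simp_all

lemma finite_sqroot_pairs [simp]: "finite (sqroot_pairs r j M H)"
  unfolding sqroot_pairs_Sigma using finite_near_pairs by (intro finite_imageI finite_SigmaI) auto

lemma near_distinct_iff: "near_distinct H a b \<longleftrightarrow> 1 \<le> \<bar>a - b\<bar> \<and> \<bar>a - b\<bar> \<le> \<lfloor>H\<rfloor>"
  by (simp add: near_distinct_def le_floor_iff)

lemma near_distinct_sym: "near_distinct H a b \<longleftrightarrow> near_distinct H b a"
  by (simp add: near_distinct_def abs_minus_commute)

lemma card_near_le:
  assumes "H \<ge> 0"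
  shows "real (card {b. near_distinct H a b}) \<le> 2 * H"
proof -
  have "{b. near_distinct H a b} \<subseteq> {a - \<lfloor>H\<rfloor>..a - 1} \<union> {a + 1..a + \<lfloor>H\<rfloor>}"
    by (auto simp: near_distinct_iff)
  then have "card {b. near_distinct H a b} \<le> card ({a - \<lfloor>H\<rfloor>..a - 1} \<union> {a + 1..a + \<lfloor>H\<rfloor>})"
    by (intro card_mono) auto
  also have "\<dots> \<le> card {a - \<lfloor>H\<rfloor>..a - 1} + card {a + 1..a + \<lfloor>H\<rfloor>}" by (rule card_Un_le)
  also have "\<dots> = nat (2 * \<lfloor>H\<rfloor>)" using assms by simp
  finally have "int (card {b. near_distinct H a b}) \<le> 2 * \<lfloor>H\<rfloor>" using assms by (simp add: nat_le_iff[symmetric] le_nat_iff)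
  then show ?thesis by linarith
qed

lemma finite_near: "finite {b. near_distinct H a b}"
  by (rule finite_subset[of _ "{a - \<lfloor>H\<rfloor>..a + \<lfloor>H\<rfloor>}"]) (auto simp: near_distinct_iff)

text \<open>The product of two root counts is at most the mean of their squares. Exchanging
  \<open>m1\<close> and \<open>m2\<close> makes both halves equal, and each \<open>m1\<close> has at
  most \<open>2 * H\<close> partners, which leaves the second moment of the root count.\<close>

lemma card_sqroot_pairs_le:
  fixes r j :: int and M H :: real
  assumes r: "r > 0" and j: "coprime r j" and M: "M \<ge> 0" and H: "H \<ge> 0"
  shows "real (card (sqroot_pairs r j M H)) \<le> 8 * H * M * (real (ndiv r)) ^ 3"
proof -
  let ?I = "{1..\<lfloor>M\<rfloor>}"
  let ?Q = "near_pairs M H"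
  define \<rho> where "\<rho> m = real (card (sqroots r (j * m)))" for m
  have "inj_on (\<lambda>((m1, m2), k1, k2). (m1, m2, k1, k2)) X" for X :: "((int \<times> int) \<times> int \<times> int) set"
    by (auto simp: inj_on_def)
  then have "real (card (sqroot_pairs r j M H)) = (\<Sum>p\<in>?Q. \<rho> (fst p) * \<rho> (snd p))"
    unfolding sqroot_pairs_Sigma using finite_near_pairs[of M H]
    by (simp add: card_image card_cartesian_product \<rho>_def)
  also have "\<dots> \<le> (\<Sum>p\<in>?Q. ((\<rho> (fst p))\<^sup>2 + (\<rho> (snd p))\<^sup>2) / 2)"
  proof (rule sum_mono)
    fix p
    show "\<rho> (fst p) * \<rho> (snd p) \<le> ((\<rho> (fst p))\<^sup>2 + (\<rho> (snd p))\<^sup>2) / 2"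
      using sum_squares_bound[of "\<rho> (fst p)" "\<rho> (snd p)"] by simp
  qed
  also have "\<dots> = ((\<Sum>p\<in>?Q. (\<rho> (fst p))\<^sup>2) + (\<Sum>p\<in>?Q. (\<rho> (snd p))\<^sup>2)) / 2"
    by (simp add: sum.distrib sum_divide_distrib[symmetric])
  also have "(\<Sum>p\<in>?Q. (\<rho> (snd p))\<^sup>2) = (\<Sum>p\<in>?Q. (\<rho> (fst p))\<^sup>2)"
  proof -
    have mem: "prod.swap p \<in> ?Q" if "p \<in> ?Q" for p
      using that near_distinct_sym[of H "fst p" "snd p"] by (cases p) (simp add: near_pairs_def)
    show ?thesis
      by (rule sum.reindex_bij_witness[of _ prod.swap prod.swap]) (simp_all add: mem)
  qed
  also have "(\<Sum>p\<in>?Q. (\<rho> (fst p))\<^sup>2) = (\<Sum>m1\<in>?I. \<Sum>m2\<in>{m2 \<in> ?I. near_distinct H m1 m2}. (\<rho> m1)\<^sup>2)"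
  proof -
    have "\<forall>m1\<in>?I. finite {m2 \<in> ?I. near_distinct H m1 m2}" by (intro ballI finite_Collect_conjI disjI1) simp
    from sum.Sigma[OF _ this, of "\<lambda>m1 m2. (\<rho> m1)\<^sup>2"] show ?thesis
      by (simp only: near_pairs_def case_prod_unfold finite_atLeastAtMost_int)
  qed
  also have "\<dots> \<le> (\<Sum>m1\<in>?I. 2 * H * (\<rho> m1)\<^sup>2)"
  proof (rule sum_mono)
    fix m1
    have "card {m2 \<in> ?I. near_distinct H m1 m2} \<le> card {m2. near_distinct H m1 m2}"
      using finite_near by (intro card_mono) auto
    then have "real (card {m2 \<in> ?I. near_distinct H m1 m2}) \<le> 2 * H"
      using card_near_le[OF H, of m1] by linarith
    then show "(\<Sum>m2\<in>{m2 \<in> ?I. near_distinct H m1 m2}. (\<rho> m1)\<^sup>2) \<le> 2 * H * (\<rho> m1)\<^sup>2"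
      by (simp add: mult_right_mono)
  qed
  also have "\<dots> = 2 * H * (\<Sum>m1\<in>?I. (\<rho> m1)\<^sup>2)" by (simp add: sum_distrib_left)
  also have "\<dots> \<le> 2 * H * (4 * M * (real (ndiv r)) ^ 3)"
    using sum_card_sqroots_sq_le[OF r j M] H unfolding \<rho>_def by (intro mult_left_mono) auto
  finally show ?thesis by (simp add: mult.assoc)
qed

section \<open>Points on the conic\<close>

text \<open>The pairs \<open>(D, t)\<close> with \<open>D\<close> congruent to \<open>x * t\<close>
  modulo \<open>r\<close> form a lattice. The condition says that every lattice point on the line
  through the origin and \<open>(a, b)\<close> is an integer multiple of
  \<open>(a, b)\<close>.\<close>

definition generates_line :: "int \<Rightarrow> int \<Rightarrow> int \<Rightarrow> int \<Rightarrow> bool" where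
  "generates_line r x a b \<longleftrightarrow>
     (\<forall>D t. r dvd D - x * t \<longrightarrow> b * D = a * t \<longrightarrow> (\<exists>\<gamma>. D = \<gamma> * a \<and> t = \<gamma> * b))"

text \<open>Dirichlet's theorem shows that an admissible vector exists with second coordinate at
  most \<open>N\<close>. Taking the one with least \<open>b\<close> makes it a generator of its
  line, because division with remainder would otherwise produce a smaller one.\<close>

lemma good_lattice_vector:
  fixes r x :: int and B :: real
  assumes r: "r > 0" and B: "B \<ge> 1"
  obtains a b where "1 \<le> b" "real_of_int b \<le> B" "real_of_int \<bar>a\<bar> \<le> 2 * r / B" "\<bar>a\<bar> \<le> r" "r dvd a - x * b"
    "generates_line r x a b"
proof -
  \<comment> \<open>Dirichlet's theorem needs an integer. Rounding down loses at most a factor 2 as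
    \<open>B \<ge> 1\<close>, and this is the 2 in \<open>2 * r / B\<close>.\<close>
  define N where "N = nat \<lfloor>B\<rfloor>"
  have N: "N \<ge> 1" "real N \<le> B" "B \<le> 2 * real N"
  proof -
    have "real N = real_of_int \<lfloor>B\<rfloor>" "\<lfloor>B\<rfloor> \<ge> 1" using B by (simp_all add: N_def)
    then show "N \<ge> 1" "real N \<le> B" "B \<le> 2 * real N" by linarith+
  qed
  define P where "P b \<longleftrightarrow> b > 0 \<and> (\<exists>a. \<bar>a\<bar> * int N < r \<and> r dvd a - x * int b)" for b :: nat
  have "0 < N" using N by simp
  then obtain h k where hk: "0 < k" "k \<le> int N" "\<bar>of_int k * (x / r) - of_int h\<bar> < 1 / N"
    by (rule Dirichlet_approx)
  have "real_of_int \<bar>k * x - h * r\<bar> = \<bar>of_int k * (x / r) - of_int h\<bar> * r"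
  proof -
    have "real_of_int (k * x - h * r) = (of_int k * (x / r) - of_int h) * r" using r by (simp add: field_simps)
    then show ?thesis using r by (simp add: abs_mult)
  qed
  also have "\<dots> < 1 / N * r" using hk(3) r by (intro mult_strict_right_mono) auto
  finally have "real_of_int \<bar>k * x - h * r\<bar> * real N < r" using N by (simp add: field_simps)
  then have "real_of_int (\<bar>k * x - h * r\<bar> * int N) < real_of_int r" by simp
  then have "\<bar>k * x - h * r\<bar> * int N < r" by (simp only: of_int_less_iff)
  moreover have "r dvd (k * x - h * r) - x * int (nat k)" using hk(1) by simp
  ultimately have Pk: "P (nat k)" unfolding P_def using hk(1) by auto
  define b where "b = (LEAST b. P b)"
  have Pb: "P b" unfolding b_def using Pk by (rule LeastI)
  have least: "b \<le> b'" if "P b'" for b' unfolding b_def using that by (rule Least_le)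
  obtain a where a: "\<bar>a\<bar> * int N < r" "r dvd a - x * int b" and b0: "b > 0"
    using Pb unfolding P_def by blast
  show thesis
  proof
    show "1 \<le> int b" using b0 by simp
    have "b \<le> N" using least[OF Pk] hk(2) by simp
    then show "real_of_int (int b) \<le> B" using N by simp
    have "real_of_int \<bar>a\<bar> * real N \<le> r" using a(1) by (metis of_int_le_iff of_int_mult of_int_of_nat_eq less_imp_le)
    then have "real_of_int \<bar>a\<bar> * (2 * real N) \<le> 2 * r" by simp
    then have "real_of_int \<bar>a\<bar> * B \<le> 2 * r" using N(3) by (smt (verit) abs_ge_zero mult_left_mono of_int_0_le_iff)
    then show "real_of_int \<bar>a\<bar> \<le> 2 * r / B" using B by (simp add: field_simps)
    have "\<bar>a\<bar> * 1 \<le> \<bar>a\<bar> * int N" using N by (intro mult_left_mono) auto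
    then show "\<bar>a\<bar> \<le> r" using a(1) by linarith
    show "r dvd a - x * int b" by fact
    show "generates_line r x a (int b)"
      unfolding generates_line_def
    proof (intro allI impI)
      fix D t assume D: "r dvd D - x * t" "int b * D = a * t"
      define \<gamma> where "\<gamma> = t div int b"
      define \<rho> where "\<rho> = t mod int b"
      have t: "t = \<gamma> * int b + \<rho>" by (simp add: \<gamma>_def \<rho>_def)
      have \<rho>: "0 \<le> \<rho>" "\<rho> < int b" using b0 by (simp_all add: \<rho>_def)
      define D' where "D' = D - \<gamma> * a"
      have bD': "int b * D' = a * \<rho>" using D(2) t by (simp add: D'_def algebra_simps)
      have "D' - x * \<rho> = (D - x * t) - \<gamma> * (a - x * int b)" by (simp add: D'_def t algebra_simps)
      then have rD': "r dvd D' - x * \<rho>" using D(1) a(2) by simp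
      \<comment> \<open>Otherwise \<open>(D', \<rho>)\<close> is a lattice vector on the same line
        with \<open>\<bar>D'\<bar> \<le> \<bar>a\<bar>\<close> and \<open>0 < \<rho> < b\<close>,
        against the minimality of \<open>b\<close>.\<close>
      have "\<rho> = 0"
      proof (rule ccontr)
        assume "\<rho> \<noteq> 0"
        have "int b * \<bar>D'\<bar> = \<bar>a\<bar> * \<rho>" using arg_cong[OF bD', of abs] \<rho> by (simp add: abs_mult)
        also have "\<dots> \<le> \<bar>a\<bar> * int b" using \<rho> by (intro mult_left_mono) auto
        also have "\<dots> = int b * \<bar>a\<bar>" by (rule mult.commute)
        finally have "\<bar>D'\<bar> \<le> \<bar>a\<bar>" using b0 by simp
        then have "\<bar>D'\<bar> * int N \<le> \<bar>a\<bar> * int N" by (intro mult_right_mono) auto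
        then have "P (nat \<rho>)" using a(1) rD' \<rho> \<open>\<rho> \<noteq> 0\<close> unfolding P_def by (intro conjI exI[of _ D']) auto
        then show False using least[of "nat \<rho>"] \<rho> by linarith
      qed
      then have "t = \<gamma> * int b" "D = \<gamma> * a" using t bD' b0 by (auto simp: D'_def)
      then show "\<exists>\<gamma>. D = \<gamma> * a \<and> t = \<gamma> * int b" by blast
    qed
  qed
qed

text \<open>The summand is the square of the interval length \<open>\<surd>(Y \<bar>a\<bar> / b)\<close> available to \<open>h\<close> over the spacing
  \<open>\<bar>a\<bar> / f\<close> of one residue class. For \<open>a = 0\<close> it is \<open>0\<close> (division by zero).\<close>

definition conic_weight :: "real \<Rightarrow> real \<Rightarrow> int \<Rightarrow> int \<Rightarrow> real" where
  "conic_weight H Y a b = (\<Sum>f | f \<in> {1..\<lfloor>2 * H\<rfloor>} \<and> f\<^sup>2 dvd a. Y * (real_of_int f)\<^sup>2 / real_of_int (b * \<bar>a\<bar>))"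

lemma conic_weight_nonneg: "Y \<ge> 0 \<Longrightarrow> b \<ge> 0 \<Longrightarrow> conic_weight H Y a b \<ge> 0"
  unfolding conic_weight_def by (intro sum_nonneg) simp

text \<open>Equal signs give \<open>\<bar>h - h'\<bar> \<le> \<bar>h + h'\<bar>\<close>. A bound on
  the difference of two squares thus confines \<open>h\<close> to an interval of square-root
  length.\<close>

lemma sq_diff_le_abs_diff_sq:
  fixes h h' :: int
  assumes "sgn h = sgn h'"
  shows "(h - h')\<^sup>2 \<le> \<bar>h\<^sup>2 - h'\<^sup>2\<bar>"
proof -
  have "\<bar>h - h'\<bar> \<le> \<bar>h + h'\<bar>" using assms by (auto simp: sgn_if split: if_splits)
  then have "\<bar>h - h'\<bar> * \<bar>h - h'\<bar> \<le> \<bar>h - h'\<bar> * \<bar>h + h'\<bar>" by (intro mult_left_mono) auto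
  then show ?thesis by (simp add: abs_mult[symmetric] power2_eq_square algebra_simps)
qed

text \<open>Points are sorted by the sign of \<open>h\<close> and by the gcd of
  \<open>\<bar>a\<bar>\<close> with \<open>h - h0\<close>. Within a class the values of
  \<open>h\<close> are spaced by \<open>\<bar>a\<bar> / f\<close> with \<open>f\<close> an overlap,
  while \<open>\<bar>\<gamma>\<bar> \<le> Y / b\<close> keeps them within
  \<open>sqrt (Y * \<bar>a\<bar> / b)\<close> of each other. The quotient of these lengths is the
  root of one term of the weight.\<close>

lemma card_collinear_class_le:
  fixes A :: "(int \<times> int) set" and H Y :: real
  assumes fin: "finite A" and a: "a \<noteq> 0" and b: "b > 0" and Y: "Y \<ge> 0"
    and step: "\<And>p q. p \<in> A \<Longrightarrow> q \<in> A \<Longrightarrow> \<exists>\<gamma>. (fst p)\<^sup>2 - (fst q)\<^sup>2 = \<gamma> * a \<and> snd p - snd q = \<gamma> * b"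
    and h: "\<And>p. p \<in> A \<Longrightarrow> fst p \<noteq> 0 \<and> real_of_int \<bar>fst p\<bar> \<le> H"
    and T: "\<And>p q. p \<in> A \<Longrightarrow> q \<in> A \<Longrightarrow> real_of_int \<bar>snd p - snd q\<bar> \<le> Y"
  shows "real (card A) \<le> 2 * real (ndiv a) * (1 + sqrt (conic_weight H Y a b))"
proof (cases "A = {}")
  case True
  then show ?thesis using Y b by (simp add: conic_weight_nonneg)
next
  case False
  then obtain p0 where p0: "p0 \<in> A" by blast
  define a' where "a' = \<bar>a\<bar>"
  have a': "a' > 0" using a by (simp add: a'_def)
  have sq: "a' dvd (fst p)\<^sup>2 - (fst p0)\<^sup>2" if "p \<in> A" for p
    using step[OF that p0] by (auto simp: a'_def)
  let ?D = "{d. 0 < d \<and> d dvd a}"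
  have "real (card A) \<le> real (card ({- 1, 1 :: int} \<times> ?D)) * (1 + sqrt (conic_weight H Y a b))"
  proof (rule card_le_fibers[where g = "\<lambda>p. (sgn (fst p), gcd a' (fst p - fst p0))"])
    show "(\<lambda>p. (sgn (fst p), gcd a' (fst p - fst p0))) ` A \<subseteq> {- 1, 1} \<times> ?D"
    proof (rule image_subsetI)
      fix p assume "p \<in> A"
      then have "fst p \<noteq> 0" using h by blast
      moreover have "gcd a' (fst p - fst p0) dvd a" unfolding a'_def by (metis abs_dvd_iff dvd_abs_iff gcd_dvd1)
      ultimately show "(sgn (fst p), gcd a' (fst p - fst p0)) \<in> {- 1, 1} \<times> ?D"
        using a' by (auto simp: sgn_if)
    qed
  next
    fix su assume "su \<in> {- 1, 1 :: int} \<times> ?D"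
    obtain s u where su: "su = (s, u)" by fastforce
    let ?F = "{p \<in> A. (sgn (fst p), gcd a' (fst p - fst p0)) = su}"
    show "real (card ?F) \<le> 1 + sqrt (conic_weight H Y a b)"
    proof (cases "?F = {}")
      case True
      then show ?thesis by (simp only: True card.empty) (simp add: conic_weight_nonneg Y b less_imp_le)
    next
      case False
      then obtain p1 where p1: "p1 \<in> A" "gcd a' (fst p1 - fst p0) = u" using su by auto
      define f where "f = overlap a' u"
      have ua: "u dvd a'" using p1(2) by auto
      have f: "f > 0" "f dvd a'" "f\<^sup>2 dvd a'" using overlap_props[OF a' ua] by (simp_all add: f_def)
      have "f dvd 2 * fst p0" using overlap_dvd_twice(2)[OF a' sq[OF p1(1)] p1(2)] by (simp add: f_def)
      \<comment> \<open>Here \<open>h \<noteq> 0\<close> is essential: it limits \<open>f\<close> to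
        the range of summation in \<open>conic_weight\<close>.\<close>
      then have "f \<le> \<bar>2 * fst p0\<bar>" using h[OF p0] by (intro zdvd_imp_le) auto
      then have f2: "f \<le> \<lfloor>2 * H\<rfloor>" using h[OF p0] by (simp add: le_floor_iff abs_mult) linarith
      obtain q where q: "a' = f * q" using f(2) by blast
      have q0: "q > 0" using q a' f(1) by (simp add: zero_less_mult_iff)
      have inj: "inj_on fst ?F"
      proof (rule inj_onI)
        fix p p' assume "p \<in> ?F" "p' \<in> ?F" and e: "fst p = fst p'"
        then obtain \<gamma> where "(fst p)\<^sup>2 - (fst p')\<^sup>2 = \<gamma> * a" "snd p - snd p' = \<gamma> * b" using step[of p p'] by blast
        then show "p = p'" using e a by (simp add: prod_eq_iff)
      qed
      have "real (card (fst ` ?F)) \<le> 1 + sqrt (Y * a' / b) / q"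
      proof (rule card_spaced_le)
        show "finite (fst ` ?F)" using fin by simp
        show "0 \<le> sqrt (Y * a' / b)" using Y a' b by simp
        fix x y assume "x \<in> fst ` ?F" "y \<in> fst ` ?F"
        then obtain p p' where p: "p \<in> A" "x = fst p" "sgn (fst p) = s" "gcd a' (fst p - fst p0) = u"
          and p': "p' \<in> A" "y = fst p'" "sgn (fst p') = s" "gcd a' (fst p' - fst p0) = u" using su by auto
        have "a' dvd f * (x - y)" unfolding f_def p p'
          by (rule same_gcd_dvd[OF a' sq[OF p(1)] p(4) sq[OF p'(1)] p'(4)])
        then show "q dvd x - y" using q f(1) by simp
        obtain \<gamma> where \<gamma>: "(fst p)\<^sup>2 - (fst p')\<^sup>2 = \<gamma> * a" "snd p - snd p' = \<gamma> * b" using step[OF p(1) p'(1)] by blast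
        have "real_of_int \<bar>\<gamma>\<bar> * b \<le> Y" using T[OF p(1) p'(1)] \<gamma>(2) b by (simp add: abs_mult)
        then have "real_of_int \<bar>\<gamma>\<bar> \<le> Y / b" using b by (simp add: field_simps)
        have "(x - y)\<^sup>2 \<le> \<bar>\<gamma>\<bar> * a'"
          using sq_diff_le_abs_diff_sq[of "fst p" "fst p'"] p(2,3) p'(2,3) \<gamma>(1) by (simp add: abs_mult a'_def)
        then have "real_of_int ((x - y)\<^sup>2) \<le> real_of_int (\<bar>\<gamma>\<bar> * a')" by (simp only: of_int_le_iff)
        also have "\<dots> \<le> Y / b * a'"
          using mult_right_mono[OF \<open>real_of_int \<bar>\<gamma>\<bar> \<le> Y / b\<close>, of a'] a' by simp
        finally have "(real_of_int \<bar>x - y\<bar>)\<^sup>2 \<le> Y * a' / b" by simp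
        then show "real_of_int \<bar>x - y\<bar> \<le> sqrt (Y * a' / b)" by (rule real_le_rsqrt)
      qed (use q0 in simp)
      moreover have "sqrt (Y * a' / b) / q \<le> sqrt (conic_weight H Y a b)"
      proof -
        have "(sqrt (Y * a' / b) / q)\<^sup>2 = Y * a' / b / (real_of_int q)\<^sup>2"
          using Y a' b by (simp add: power_divide)
        also have "\<dots> = Y * (real_of_int f)\<^sup>2 / real_of_int (b * \<bar>a\<bar>)"
          using q q0 f(1) b a'_def by (simp add: power2_eq_square field_simps)
        also have "\<dots> \<le> conic_weight H Y a b"
          unfolding conic_weight_def using f f2 Y b a'_def
          by (intro member_le_sum[of f _ "\<lambda>f. Y * (real_of_int f)\<^sup>2 / real_of_int (b * \<bar>a\<bar>)"]) (auto intro: finite_subset[of _ "{1..\<lfloor>2 * H\<rfloor>}"])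
        finally show ?thesis by (rule real_le_rsqrt)
      qed
      moreover have "card (fst ` ?F) = card ?F" by (rule card_image[OF inj])
      ultimately show ?thesis by linarith
    qed
  qed (use fin a in simp_all)
  then show ?thesis by (simp add: card_cartesian_product ndiv_def)
qed

definition conic_points :: "int \<Rightarrow> int \<Rightarrow> real \<Rightarrow> real \<Rightarrow> (int \<times> int) set" where
  "conic_points r x H Y = {(h, T). h \<noteq> 0 \<and> real_of_int \<bar>h\<bar> \<le> H \<and> 0 \<le> T \<and> real_of_int T \<le> Y \<and>
     r dvd h\<^sup>2 - x * T + x\<^sup>2}"

lemma finite_conic_points: "finite (conic_points r x H Y)"
  unfolding conic_points_def
  by (rule finite_subset[of _ "{- \<lfloor>H\<rfloor>..\<lfloor>H\<rfloor>} \<times> {0..\<lfloor>Y\<rfloor>}"]) (auto simp: le_floor_iff abs_le_iff minus_le_iff)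

text \<open>Multiplying the conic equation by \<open>b\<close> and replacing \<open>x * b\<close> by
  \<open>a\<close> shows that \<open>b * h\<^sup>2 - a * T\<close> is congruent to
  \<open>- b * x\<^sup>2\<close> modulo \<open>r\<close>. Its values are thus spaced by
  \<open>r\<close> in an interval of length
  \<open>b * H\<^sup>2 + Y * \<bar>a\<bar>\<close>.\<close>

lemma card_conic_points_le_classes:
  fixes r x a b :: int and H Y :: real
  assumes r: "r > 0" and b: "b > 0" and Y: "Y \<ge> 0" and H: "H \<ge> 0" and ab: "r dvd a - x * b"
    and W: "\<And>c. real (card {p \<in> conic_points r x H Y. b * (fst p)\<^sup>2 - a * snd p = c}) \<le> W"
  shows "real (card (conic_points r x H Y)) \<le> (1 + (b * H\<^sup>2 + Y * \<bar>a\<bar>) / r) * W"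
proof -
  let ?S = "conic_points r x H Y" and ?c = "\<lambda>p. b * (fst p)\<^sup>2 - a * snd p"
  have fin: "finite ?S" by (rule finite_conic_points)
  have W0: "W \<ge> 0" using W[of 0] by linarith
  have "real (card (?c ` ?S)) \<le> 1 + (b * H\<^sup>2 + Y * \<bar>a\<bar>) / r"
  proof (rule card_spaced_le)
    fix u v assume "u \<in> ?c ` ?S" "v \<in> ?c ` ?S"
    then obtain p q where p: "p \<in> ?S" "u = ?c p" and q: "q \<in> ?S" "v = ?c q" by auto
    have "r dvd ?c p + b * x\<^sup>2" if "p \<in> ?S" for p
    proof -
      have "?c p + b * x\<^sup>2 = b * ((fst p)\<^sup>2 - x * snd p + x\<^sup>2) - (a - x * b) * snd p" by (simp add: algebra_simps)
      moreover have "r dvd (fst p)\<^sup>2 - x * snd p + x\<^sup>2" using that by (auto simp: conic_points_def)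
      ultimately show ?thesis using ab by (metis dvd_diff dvd_mult dvd_mult2)
    qed
    from dvd_diff[OF this[OF p(1)] this[OF q(1)]] show "r dvd u - v" using p(2) q(2) by simp
    have sqb: "0 \<le> (real_of_int (fst p))\<^sup>2 \<and> (real_of_int (fst p))\<^sup>2 \<le> H\<^sup>2" if "p \<in> ?S" for p
      using that abs_le_square_iff[of "real_of_int (fst p)" H] H by (auto simp: conic_points_def)
    have Tb: "0 \<le> real_of_int (snd p) \<and> real_of_int (snd p) \<le> Y" if "p \<in> ?S" for p
      using that by (auto simp: conic_points_def)
    have "real_of_int \<bar>u - v\<bar> = \<bar>b * ((real_of_int (fst p))\<^sup>2 - (real_of_int (fst q))\<^sup>2) - a * (real_of_int (snd p) - real_of_int (snd q))\<bar>"
      by (simp add: p(2) q(2) algebra_simps)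
    also have "\<dots> \<le> \<bar>b * ((real_of_int (fst p))\<^sup>2 - (real_of_int (fst q))\<^sup>2)\<bar> + \<bar>a * (real_of_int (snd p) - real_of_int (snd q))\<bar>"
      by (rule abs_triangle_ineq4)
    also have "\<dots> \<le> b * H\<^sup>2 + Y * \<bar>a\<bar>"
    proof (rule add_mono)
      show "\<bar>b * ((real_of_int (fst p))\<^sup>2 - (real_of_int (fst q))\<^sup>2)\<bar> \<le> b * H\<^sup>2"
      proof -
        have "\<bar>(real_of_int (fst p))\<^sup>2 - (real_of_int (fst q))\<^sup>2\<bar> \<le> H\<^sup>2"
          using sqb[OF p(1)] sqb[OF q(1)] by (elim conjE) linarith
        then show ?thesis using b by (simp add: abs_mult mult_left_mono)
      qed
      show "\<bar>a * (real_of_int (snd p) - real_of_int (snd q))\<bar> \<le> Y * \<bar>a\<bar>"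
      proof -
        have "\<bar>real_of_int (snd p) - real_of_int (snd q)\<bar> \<le> Y"
          using Tb[OF p(1)] Tb[OF q(1)] by (elim conjE) linarith
        then show ?thesis by (simp add: abs_mult mult.commute[of Y] mult_left_mono)
      qed
    qed
    finally show "real_of_int \<bar>u - v\<bar> \<le> b * H\<^sup>2 + Y * \<bar>a\<bar>" .
  qed (use fin r b Y H in auto)
  moreover have "real (card ?S) \<le> real (card (?c ` ?S)) * W"
    using fin by (intro card_le_fibers[where g = ?c] W) auto
  ultimately show ?thesis using W0 by (meson mult_right_mono order_trans)
qed

text \<open>Differences within a class lie on the line of \<open>(a, b)\<close>, which supplies the
  multiplier \<open>\<gamma>\<close>. If \<open>a = 0\<close>, a class has constant
  \<open>h\<^sup>2\<close> and \<open>T\<close> moves in steps of \<open>b\<close>; moreover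
  \<open>r\<close> divides \<open>x * b\<close>, so it divides the nonzero number
  \<open>b * h\<^sup>2\<close>, which forces \<open>r \<le> b * H\<^sup>2\<close>.\<close>

lemma card_conic_points_le:
  fixes r x a b :: int and H Y :: real
  assumes r: "r > 0" and b: "b > 0" and Y: "Y \<ge> 0" and H: "H \<ge> 0" and ab: "r dvd a - x * b"
    and prim: "generates_line r x a b"
  shows "a \<noteq> 0 \<Longrightarrow> real (card (conic_points r x H Y)) \<le>
           (1 + (b * H\<^sup>2 + Y * \<bar>a\<bar>) / r) * (2 * real (ndiv a) * (1 + sqrt (conic_weight H Y a b)))"
    and "a = 0 \<Longrightarrow> real (card (conic_points r x H Y)) \<le> (1 + b * H\<^sup>2 / r) * (2 * (1 + Y / b))"
    and "a = 0 \<Longrightarrow> conic_points r x H Y \<noteq> {} \<Longrightarrow> r \<le> b * H\<^sup>2"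
proof -
  let ?S = "conic_points r x H Y"
  have fin: "finite ?S" by (rule finite_conic_points)
  have step: "\<exists>\<gamma>. (fst p)\<^sup>2 - (fst q)\<^sup>2 = \<gamma> * a \<and> snd p - snd q = \<gamma> * b"
    if "p \<in> ?S" "q \<in> ?S" "b * (fst p)\<^sup>2 - a * snd p = c" "b * (fst q)\<^sup>2 - a * snd q = c" for p q c
  proof (rule prim[unfolded generates_line_def, rule_format])
    have "r dvd (fst p)\<^sup>2 - x * snd p + x\<^sup>2" "r dvd (fst q)\<^sup>2 - x * snd q + x\<^sup>2"
      using that by (auto simp: conic_points_def)
    from dvd_diff[OF this] show "r dvd (fst p)\<^sup>2 - (fst q)\<^sup>2 - x * (snd p - snd q)" by (simp add: algebra_simps)
    show "b * ((fst p)\<^sup>2 - (fst q)\<^sup>2) = a * (snd p - snd q)" using that(3,4) by (simp add: algebra_simps)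
  qed
  have hp: "fst p \<noteq> 0 \<and> real_of_int \<bar>fst p\<bar> \<le> H" if "p \<in> ?S" for p using that by (auto simp: conic_points_def)
  have Tp: "real_of_int \<bar>snd p - snd q\<bar> \<le> Y" if "p \<in> ?S" "q \<in> ?S" for p q
  proof -
    have "0 \<le> snd p \<and> real_of_int (snd p) \<le> Y" "0 \<le> snd q \<and> real_of_int (snd q) \<le> Y"
      using that by (auto simp: conic_points_def)
    then show ?thesis by (simp add: abs_le_iff)
  qed
  {
    assume a: "a \<noteq> 0"
    show "real (card ?S) \<le> (1 + (b * H\<^sup>2 + Y * \<bar>a\<bar>) / r) * (2 * real (ndiv a) * (1 + sqrt (conic_weight H Y a b)))"
    proof (rule card_conic_points_le_classes[OF r b Y H ab])
      fix c
      show "real (card {p \<in> ?S. b * (fst p)\<^sup>2 - a * snd p = c}) \<le> 2 * real (ndiv a) * (1 + sqrt (conic_weight H Y a b))"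
        by (rule card_collinear_class_le) (use fin a b Y step hp Tp in simp_all)
    qed
  }
  {
    assume a: "a = 0"
    have "real (card {p \<in> ?S. b * (fst p)\<^sup>2 - a * snd p = c}) \<le> 2 * (1 + Y / b)" for c
    proof -
      let ?C = "{p \<in> ?S. b * (fst p)\<^sup>2 - a * snd p = c}"
      have "real (card ?C) \<le> real (card {- 1, 1 :: int}) * (1 + Y / b)"
      proof (rule card_le_fibers[where g = "\<lambda>p. sgn (fst p)"])
        show "(\<lambda>p. sgn (fst p)) ` ?C \<subseteq> {- 1, 1}" using hp by (auto simp: sgn_if)
        fix s :: int
        let ?F = "{p \<in> ?C. sgn (fst p) = s}"
        have eq: "fst p = fst q" if "p \<in> ?F" "q \<in> ?F" for p q
        proof -
          have "(fst p)\<^sup>2 = (fst q)\<^sup>2" using step[of p q c] that a by auto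
          moreover have "sgn (fst p) = sgn (fst q)" using that by simp
          ultimately show ?thesis by (metis abs_mult_sgn abs_eq_iff power2_eq_iff mult.commute)
        qed
        have "real (card (snd ` ?F)) \<le> 1 + Y / b"
        proof (rule card_spaced_le)
          fix u v assume "u \<in> snd ` ?F" "v \<in> snd ` ?F"
          then obtain p q where pq: "p \<in> ?F" "q \<in> ?F" "u = snd p" "v = snd q" by blast
          then show "b dvd u - v" using step[of p q c] by auto
          show "real_of_int \<bar>u - v\<bar> \<le> Y" using Tp[of p q] pq by auto
        qed (use fin b Y in auto)
        moreover have "card (snd ` ?F) = card ?F"
          by (rule card_image, rule inj_onI, rule prod_eqI) (use eq in blast)+
        ultimately show "real (card ?F) \<le> 1 + Y / b" by simp
      qed (use fin in simp_all)
      then show ?thesis by simp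
    qed
    from card_conic_points_le_classes[OF r b Y H ab this] a
    show "real (card ?S) \<le> (1 + b * H\<^sup>2 / r) * (2 * (1 + Y / b))" by simp
  }
  {
    assume a: "a = 0" and "?S \<noteq> {}"
    then obtain h T where hT: "(h, T) \<in> ?S" by auto
    then have h: "h \<noteq> 0" "real_of_int \<bar>h\<bar> \<le> H" "r dvd h\<^sup>2 - x * T + x\<^sup>2" by (auto simp: conic_points_def)
    have "r dvd b * (h\<^sup>2 - x * T + x\<^sup>2) + (x * b) * (T - x)" using h(3) ab a by (intro dvd_add) auto
    then have "r dvd b * h\<^sup>2" by (simp add: algebra_simps power2_eq_square)
    then have "r \<le> b * h\<^sup>2" using b h(1) by (intro zdvd_imp_le) auto
    then have "real_of_int r \<le> b * (real_of_int h)\<^sup>2" by (metis of_int_le_iff of_int_mult of_int_power)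
    also have "\<dots> \<le> b * H\<^sup>2" using h(2) H b abs_le_square_iff[of "real_of_int h" H] by (intro mult_left_mono) auto
    finally show "real_of_int r \<le> b * H\<^sup>2" .
  }
qed

section \<open>Averaging the conic weight over the residues x\<close>

definition recip_sum :: "int \<Rightarrow> real" where
  "recip_sum r = (\<Sum>i\<in>{1..r}. 1 / real_of_int i)"

lemma recip_sum_nonneg: "recip_sum r \<ge> 0"
  unfolding recip_sum_def by (intro sum_nonneg) auto

lemma sum_multiples_recip_le:
  fixes q r :: int
  assumes "q > 0"
  shows "(\<Sum>b | b \<in> {1..r} \<and> q dvd b. q / b) \<le> recip_sum r"
proof -
  have "(\<Sum>b | b \<in> {1..r} \<and> q dvd b. q / b) = (\<Sum>c\<in>{1..r div q}. 1 / real_of_int c)"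
  proof (rule sum.reindex_bij_witness[of _ "\<lambda>c. q * c" "\<lambda>b. b div q"])
    fix b assume b: "b \<in> {b. b \<in> {1..r} \<and> q dvd b}"
    then obtain c where c: "b = q * c" by auto
    then have "c \<ge> 1" using b assms by (auto simp: zero_less_mult_iff int_one_le_iff_zero_less)
    moreover have "c \<le> r div q" using zdiv_mono1[of b r q] b c assms by simp
    ultimately show "b div q \<in> {1..r div q}" using c assms by simp
    show "1 / real_of_int (b div q) = real_of_int q / real_of_int b" using c assms by simp
    show "q * (b div q) = b" using c assms by simp
  next
    fix c assume c: "c \<in> {1..r div q}"
    then show "q * c div q = c" using assms by simp
    have "q * c \<le> q * (r div q)" using c assms by (intro mult_left_mono) auto
    also have "\<dots> \<le> r" using mult_div_mod_eq[of q r] pos_mod_sign[OF assms, of r] by linarith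
    finally have "q * c \<le> r" .
    moreover have "1 \<le> q * c" using c assms by (simp add: int_one_le_iff_zero_less)
    ultimately show "q * c \<in> {b. b \<in> {1..r} \<and> q dvd b}" by simp
  qed
  also have "\<dots> \<le> recip_sum r"
  proof (cases "r > 0")
    case True
    have "r div q \<le> r" using True assms by (metis div_by_1 int_one_le_iff_zero_less less_imp_le zdiv_mono2 zero_less_one)
    then show ?thesis unfolding recip_sum_def by (intro sum_mono2) auto
  next
    case False
    then have "r div q \<le> 0" using assms by (metis div_0 not_less zdiv_mono1)
    then show ?thesis by (simp add: recip_sum_nonneg)
  qed
  finally show ?thesis .
qed

text \<open>The gcd is at most the sum of all positive common divisors of \<open>b\<close> and
  \<open>r\<close>. For a fixed divisor \<open>g\<close> the multiples of \<open>g\<close>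
  contribute at most a harmonic sum.\<close>

lemma sum_gcd_recip_le:
  fixes r :: int
  assumes "r > 0"
  shows "(\<Sum>b\<in>{1..r}. gcd b r / b) \<le> ndiv r * recip_sum r"
proof -
  let ?D = "{d. 0 < d \<and> d dvd r}"
  have fin: "finite ?D" using assms by simp
  have "(\<Sum>b\<in>{1..r}. gcd b r / b) \<le> (\<Sum>b\<in>{1..r}. \<Sum>g\<in>?D. if g dvd b then g / b else 0)"
  proof (rule sum_mono)
    fix b assume "b \<in> {1..r}"
    then have "gcd b r \<in> ?D" "gcd b r dvd b" using assms by auto
    then show "gcd b r / b \<le> (\<Sum>g\<in>?D. if g dvd b then g / b else 0)"
      using member_le_sum[of "gcd b r" ?D "\<lambda>g. if g dvd b then real_of_int g / b else 0"] fin \<open>b \<in> {1..r}\<close> by auto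
  qed
  also have "\<dots> = (\<Sum>g\<in>?D. \<Sum>b\<in>{1..r}. if g dvd b then g / b else 0)" by (rule sum.swap)
  also have "\<dots> \<le> (\<Sum>g\<in>?D. recip_sum r)"
  proof (rule sum_mono)
    fix g assume "g \<in> ?D"
    then show "(\<Sum>b\<in>{1..r}. if g dvd b then g / b else 0) \<le> recip_sum r"
      using sum_multiples_recip_le[of g r] by (simp add: sum.inter_filter[symmetric])
  qed
  finally show ?thesis by (simp add: ndiv_def)
qed

lemma sum_multiples_abs_recip_le:
  fixes q r :: int
  assumes "q > 0"
  shows "(\<Sum>a | a \<in> {-r..r} \<and> q dvd a. q / real_of_int \<bar>a\<bar>) \<le> 2 * recip_sum r"
proof -
  let ?P = "{b. b \<in> {1..r} \<and> q dvd b}"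
  have fP: "finite ?P" by (rule finite_subset[of _ "{1..r}"]) auto
  have sub: "{a. a \<in> {-r..r} \<and> q dvd a} \<subseteq> insert 0 (?P \<union> uminus ` ?P)"
  proof
    fix a assume a: "a \<in> {a. a \<in> {-r..r} \<and> q dvd a}"
    show "a \<in> insert 0 (?P \<union> uminus ` ?P)"
    proof (cases "a < 0")
      case True
      then have "- a \<in> ?P" using a by auto
      then have "- (- a) \<in> uminus ` ?P" by (rule imageI)
      then show ?thesis by simp
    qed (use a in auto)
  qed
  have "(\<Sum>a | a \<in> {-r..r} \<and> q dvd a. q / real_of_int \<bar>a\<bar>) \<le> (\<Sum>a\<in>insert 0 (?P \<union> uminus ` ?P). q / real_of_int \<bar>a\<bar>)"
    using fP sub assms by (intro sum_mono2) auto
  \<comment> \<open>The term at 0 vanishes because division by 0 yields 0.\<close>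
  also have "\<dots> = (\<Sum>a\<in>?P \<union> uminus ` ?P. q / real_of_int \<bar>a\<bar>)" using fP by (simp add: sum.insert_if)
  also have "\<dots> \<le> (\<Sum>a\<in>?P. q / real_of_int \<bar>a\<bar>) + (\<Sum>a\<in>uminus ` ?P. q / real_of_int \<bar>a\<bar>)"
    using fP assms by (subst sum.union_inter[symmetric]) (auto intro!: sum_nonneg)
  also have "(\<Sum>a\<in>uminus ` ?P. q / real_of_int \<bar>a\<bar>) = (\<Sum>a\<in>?P. q / real_of_int \<bar>a\<bar>)"
    by (subst sum.reindex) (auto simp: inj_on_def)
  also have "(\<Sum>a\<in>?P. q / real_of_int \<bar>a\<bar>) = (\<Sum>a\<in>?P. q / a)" by (intro sum.cong) auto
  finally show ?thesis using sum_multiples_recip_le[OF assms, of r] by linarith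
qed

text \<open>For fixed \<open>f\<close> the multiples \<open>a\<close> of \<open>f\<^sup>2\<close>
  have reciprocals summing to \<open>1 / f\<^sup>2\<close> times twice a harmonic sum at most. This
  cancels the \<open>f\<^sup>2\<close> of the weight, and there are at most \<open>2 * H\<close>
  values of \<open>f\<close>.\<close>

lemma sum_conic_weight_over_first_le:
  assumes "b > 0" "Y \<ge> 0" "H \<ge> 0"
  shows "(\<Sum>a\<in>{-r..r}. conic_weight H Y a b) \<le> 4 * H * Y * recip_sum r / b"
proof -
  let ?F = "{1..\<lfloor>2 * H\<rfloor>}"
  have "(\<Sum>a\<in>{-r..r}. conic_weight H Y a b)
      = (\<Sum>a\<in>{-r..r}. \<Sum>f\<in>?F. if f\<^sup>2 dvd a then Y * (real_of_int f)\<^sup>2 / real_of_int (b * \<bar>a\<bar>) else 0)"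
    unfolding conic_weight_def by (simp only: sum.inter_filter finite_atLeastAtMost_int)
  also have "\<dots> = (\<Sum>f\<in>?F. \<Sum>a\<in>{-r..r}. if f\<^sup>2 dvd a then Y * (real_of_int f)\<^sup>2 / real_of_int (b * \<bar>a\<bar>) else 0)"
    by (rule sum.swap)
  also have "\<dots> \<le> (\<Sum>f\<in>?F. Y / b * (2 * recip_sum r))"
  proof (rule sum_mono)
    fix f assume f: "f \<in> ?F"
    have "(\<Sum>a\<in>{-r..r}. if f\<^sup>2 dvd a then Y * (real_of_int f)\<^sup>2 / real_of_int (b * \<bar>a\<bar>) else 0)
        = (\<Sum>a | a \<in> {-r..r} \<and> f\<^sup>2 dvd a. Y / b * (real_of_int (f\<^sup>2) / real_of_int \<bar>a\<bar>))"
      by (simp add: sum.inter_filter[symmetric])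
    also have "\<dots> = Y / b * (\<Sum>a | a \<in> {-r..r} \<and> f\<^sup>2 dvd a. real_of_int (f\<^sup>2) / real_of_int \<bar>a\<bar>)"
      by (rule sum_distrib_left[symmetric])
    also have "\<dots> \<le> Y / b * (2 * recip_sum r)"
      using sum_multiples_abs_recip_le[of "f\<^sup>2" r] f assms by (intro mult_left_mono) auto
    finally show "(\<Sum>a\<in>{-r..r}. if f\<^sup>2 dvd a then Y * (real_of_int f)\<^sup>2 / real_of_int (b * \<bar>a\<bar>) else 0) \<le> Y / b * (2 * recip_sum r)" .
  qed
  also have "\<dots> = real_of_int \<lfloor>2 * H\<rfloor> * (Y / b * (2 * recip_sum r))" using assms by simp
  also have "\<dots> \<le> (2 * H) * (Y / b * (2 * recip_sum r))"
    using assms by (intro mult_right_mono mult_nonneg_nonneg) (auto simp: recip_sum_nonneg)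
  finally show ?thesis by (simp add: mult_ac)
qed

lemma dvd_gcd_mult:
  fixes r u v d :: int
  assumes "r dvd u * d" "r dvd v * d"
  shows "r dvd gcd u v * d"
proof -
  have "r dvd gcd (u * d) (v * d)" using assms by simp
  moreover have "gcd (u * d) (v * d) = \<bar>gcd u v * d\<bar>" by (metis abs_gcd_int abs_mult gcd_mult_distrib_int mult.commute)
  ultimately show ?thesis by simp
qed

lemma card_linear_congruence_le:
  fixes r a b :: int
  assumes "r > 0"
  shows "int (card {x \<in> {0..<r}. r dvd a - x * b}) \<le> gcd b r"
proof (rule card_spaced_residues_le[where r = r])
  fix x y assume "x \<in> {x \<in> {0..<r}. r dvd a - x * b}" "y \<in> {x \<in> {0..<r}. r dvd a - x * b}"
  then have "r dvd a - y * b" "r dvd a - x * b" by simp_all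
  then have "r dvd (a - y * b) - (a - x * b)" by (rule dvd_diff)
  then have "r dvd b * (x - y)" by (simp add: algebra_simps)
  then show "r dvd gcd b r * (x - y)" by (rule dvd_gcd_mult) simp
qed (use assms in auto)

text \<open>Grouping by the vector \<open>(b x, a x)\<close> replaces the unknown choice of vectors
  by a sum over all vectors in a box. The price is the multiplicity \<open>gcd b r\<close>, the most
  residues \<open>x\<close> that can satisfy the congruence for one vector.\<close>

lemma sum_conic_weight_le:
  fixes a b :: "int \<Rightarrow> int" and H Y :: real
  assumes r: "r > 0" and H: "H \<ge> 0" and Y: "Y \<ge> 0" and X: "X \<subseteq> {0..<r}"
    and ab: "\<And>x. x \<in> X \<Longrightarrow> 1 \<le> b x \<and> b x \<le> r \<and> \<bar>a x\<bar> \<le> r \<and> r dvd a x - x * b x"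
  shows "(\<Sum>x\<in>X. conic_weight H Y (a x) (b x)) \<le> 4 * H * Y * ndiv r * (recip_sum r)\<^sup>2"
proof -
  let ?R = "{1..r} \<times> {-r..r}" and ?w = "\<lambda>p. conic_weight H Y (snd p) (fst p)"
  have fX: "finite X" using X finite_subset by blast
  have "(\<Sum>x\<in>X. conic_weight H Y (a x) (b x)) = (\<Sum>p\<in>?R. \<Sum>x\<in>{x \<in> X. (b x, a x) = p}. conic_weight H Y (a x) (b x))"
    using fX ab by (intro sum.group[symmetric]) (auto simp: abs_le_iff minus_le_iff)
  also have "\<dots> \<le> (\<Sum>p\<in>?R. gcd (fst p) r * ?w p)"
  proof (rule sum_mono)
    fix p assume p: "p \<in> ?R"
    have w: "?w p \<ge> 0" using p Y by (intro conic_weight_nonneg) auto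
    have "(\<Sum>x\<in>{x \<in> X. (b x, a x) = p}. conic_weight H Y (a x) (b x)) = (\<Sum>x\<in>{x \<in> X. (b x, a x) = p}. ?w p)"
      by (intro sum.cong) auto
    also have "\<dots> = real (card {x \<in> X. (b x, a x) = p}) * ?w p" by simp
    also have "\<dots> \<le> gcd (fst p) r * ?w p"
    proof (rule mult_right_mono[OF _ w])
      have "card {x \<in> X. (b x, a x) = p} \<le> card {x \<in> {0..<r}. r dvd snd p - x * fst p}"
        using X ab by (intro card_mono finite_subset[of "{x \<in> {0..<r}. r dvd snd p - x * fst p}" "{0..<r}"]) auto
      then show "real (card {x \<in> X. (b x, a x) = p}) \<le> gcd (fst p) r"
        using card_linear_congruence_le[OF r, of "snd p" "fst p"] by linarith
    qed
    finally show "(\<Sum>x\<in>{x \<in> X. (b x, a x) = p}. conic_weight H Y (a x) (b x)) \<le> gcd (fst p) r * ?w p" .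
  qed
  also have "\<dots> = (\<Sum>b\<in>{1..r}. gcd b r * (\<Sum>a\<in>{-r..r}. conic_weight H Y a b))"
    by (simp add: sum.cartesian_product[symmetric] sum_distrib_left case_prod_unfold sum.cartesian_product)
  also have "\<dots> \<le> (\<Sum>b\<in>{1..r}. gcd b r * (4 * H * Y * recip_sum r / b))"
    using sum_conic_weight_over_first_le[OF _ Y H] by (intro sum_mono mult_left_mono) auto
  also have "\<dots> = 4 * H * Y * recip_sum r * (\<Sum>b\<in>{1..r}. gcd b r / b)"
    by (simp add: sum_distrib_left mult_ac)
  also have "\<dots> \<le> 4 * H * Y * recip_sum r * (ndiv r * recip_sum r)"
    using sum_gcd_recip_le[OF r] H Y recip_sum_nonneg by (intro mult_left_mono) auto
  finally show ?thesis by (simp add: power2_eq_square mult_ac)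
qed

text \<open>For \<open>a \<noteq> 0\<close> the product of the number of classes and the class size
  is squared directly. For \<open>a = 0\<close> the count itself is \<open>O(1 + L\<^sup>2)\<close>,
  so its square is \<open>O(1 + L\<^sup>2)\<close> times \<open>card S\<close>; hence the term
  \<open>card S\<close> on the right, which can later be summed over \<open>x\<close>.\<close>

lemma conic_points_sq_bound:
  fixes r x :: int and H M K :: real
  assumes r: "r > 0" and H: "1 \<le> H" "H \<le> M" and M: "M \<le> r"
    and K: "\<And>n. 0 < n \<Longrightarrow> n \<le> r \<Longrightarrow> real (ndiv n) \<le> K" and S: "S \<subseteq> conic_points r x H (4 * M)"
  shows "\<exists>a b. 1 \<le> b \<and> b \<le> r \<and> \<bar>a\<bar> \<le> r \<and> r dvd a - x * b \<and>
    (real (card S))\<^sup>2 \<le> 656 * (1 + H\<^sup>2 * M / r) * (real (card S) + K\<^sup>2 * (1 + conic_weight H (4 * M) a b))"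
proof -
  let ?C = "conic_points r x H (4 * M)"
  define L where "L = H * sqrt (M / r)"
  have M1: "M \<ge> 1" using H by linarith
  have L0: "L \<ge> 0" using H M1 r by (simp add: L_def)
  have L2: "L\<^sup>2 = H\<^sup>2 * M / r" using M1 r by (simp add: L_def power_mult_distrib)
  \<comment> \<open>This value balances the two parts of the interval length:
    \<open>b * H\<^sup>2 / r\<close> and \<open>4 * M * \<bar>a\<bar> / r\<close> both become a
    constant times \<open>L\<close>.\<close>
  define B where "B = sqrt (M * r) / H"
  have sM: "sqrt (M * r) = sqrt M * sqrt r" by (rule real_sqrt_mult)
  have s0: "sqrt M > 0" "sqrt r > 0" using M1 r by simp_all
  have sMr: "sqrt M \<le> sqrt r" using M by simp
  have B1: "B \<ge> 1"
  proof -
    have "H \<le> sqrt M * sqrt M" using H(2) M1 by simp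
    also have "\<dots> \<le> sqrt M * sqrt r" using sMr s0 by (intro mult_left_mono) auto
    finally show ?thesis using H sM by (simp add: B_def field_simps)
  qed
  have Br: "B \<le> r"
  proof -
    have "B \<le> sqrt M * sqrt r"
      using divide_left_mono[of 1 H "sqrt M * sqrt r"] H s0 by (simp add: B_def sM)
    also have "\<dots> \<le> sqrt r * sqrt r" using sMr s0 by (intro mult_right_mono) auto
    finally show ?thesis using r by simp
  qed
  obtain a b where ab: "1 \<le> b" "real_of_int b \<le> B" "real_of_int \<bar>a\<bar> \<le> 2 * r / B" "\<bar>a\<bar> \<le> r" "r dvd a - x * b"
    and prim: "generates_line r x a b"
    by (rule good_lattice_vector[where x = x, OF r B1])
  have b0: "b > 0" and Y0: "4 * M \<ge> 0" and H0: "H \<ge> 0" using ab M1 H by auto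
  note bounds = card_conic_points_le[OF r b0 Y0 H0 ab(5) prim]
  have finC: "finite ?C" by (rule finite_conic_points)
  have SC: "real (card S) \<le> real (card ?C)" using card_mono[OF finC S] by simp
  have rr: "sqrt r * sqrt r = real_of_int r" using r by simp
  have bL: "b * H\<^sup>2 / r \<le> L"
  proof -
    have "b * H\<^sup>2 / r \<le> B * H\<^sup>2 / r" using ab(2) r by (intro divide_right_mono mult_right_mono) auto
    also have "\<dots> = L" using H s0 r rr by (simp add: B_def L_def sM real_sqrt_divide power2_eq_square field_simps)
    finally show ?thesis .
  qed
  have aL: "4 * M * \<bar>a\<bar> / r \<le> 8 * L"
  proof -
    have "4 * M * \<bar>a\<bar> / r \<le> 4 * M * (2 * r / B) / r" using ab(3) r M1 by (intro divide_right_mono mult_left_mono) auto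
    also have "\<dots> = 8 * (sqrt M * sqrt M) / B" using r M1 by simp
    also have "\<dots> = 8 * L" using H s0 r by (simp add: B_def L_def sM real_sqrt_divide field_simps)
    finally show ?thesis .
  qed
  have K1: "K \<ge> 1" using K[of 1] ndiv_pos[of 1] r by simp
  have w0: "conic_weight H (4 * M) a b \<ge> 0" using Y0 b0 by (intro conic_weight_nonneg) auto
  let ?w = "conic_weight H (4 * M) a b"
  have "(real (card S))\<^sup>2 \<le> 656 * (1 + L\<^sup>2) * (real (card S) + K\<^sup>2 * (1 + ?w))"
  proof (cases "a = 0")
    case True
    show ?thesis
    proof (cases "S = {}")
      case True
      then show ?thesis using w0 by simp
    next
      case False
      then have ne: "?C \<noteq> {}" using S by auto
      have rb: "r \<le> b * H\<^sup>2" using bounds(3)[OF True ne] .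
      \<comment> \<open>A large \<open>v\<close> is ruled out by
        \<open>r \<le> b * H\<^sup>2\<close>, which yields \<open>v \<le> 4 * L\<^sup>2\<close>,
        while \<open>u * v\<close> does not depend on \<open>b\<close>.\<close>
      define u v where "u = b * H\<^sup>2 / r" and "v = 4 * M / b"
      have v4: "v \<le> 4 * L\<^sup>2"
        using rb b0 r M1 by (simp add: v_def L2 field_simps)
      have uv: "u * v = 4 * L\<^sup>2" using b0 r by (simp add: u_def v_def L2 field_simps)
      have "u \<le> L" using bL by (simp add: u_def)
      moreover have "2 * L \<le> 1 + L\<^sup>2" using sum_squares_bound[of 1 L] by simp
      moreover have "real (card ?C) \<le> 2 * (1 + u + v + 4 * L\<^sup>2)"
      proof -
        have "(1 + u) * (2 * (1 + v)) = 2 * (1 + u + v + u * v)" by (simp add: algebra_simps)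
        then show ?thesis using bounds(2)[OF True] unfolding uv[symmetric] by (simp only: u_def v_def)
      qed
      ultimately have "real (card ?C) \<le> 20 * (1 + L\<^sup>2)"
        using v4 zero_le_power2[of L] by argo
      then have "(real (card S))\<^sup>2 \<le> 20 * (1 + L\<^sup>2) * real (card S)"
        using SC by (simp add: power2_eq_square mult_right_mono)
      also have "\<dots> \<le> 656 * (1 + L\<^sup>2) * (real (card S) + K\<^sup>2 * (1 + ?w))"
        using w0 by (intro mult_mono) auto
      finally show ?thesis .
    qed
  next
    case False
    have "ndiv a = ndiv \<bar>a\<bar>" by (simp add: ndiv_def)
    then have na: "real (ndiv a) \<le> K" using K[of "\<bar>a\<bar>"] False ab(4) by simp
    have "(b * H\<^sup>2 + 4 * M * \<bar>a\<bar>) / r = b * H\<^sup>2 / r + 4 * M * \<bar>a\<bar> / r" by (rule add_divide_distrib)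
    then have c1: "1 + (b * H\<^sup>2 + 4 * M * \<bar>a\<bar>) / r \<le> 1 + 9 * L" using bL aL by linarith
    have c2: "2 * real (ndiv a) * (1 + sqrt ?w) \<le> 2 * K * (1 + sqrt ?w)"
      using na w0 by (intro mult_right_mono) auto
    have "(1 + (b * H\<^sup>2 + 4 * M * \<bar>a\<bar>) / r) * (2 * real (ndiv a) * (1 + sqrt ?w)) \<le> (1 + 9 * L) * (2 * K * (1 + sqrt ?w))"
      by (rule mult_mono[OF c1 c2]) (use w0 L0 K1 in auto)
    then have "real (card S) \<le> (1 + 9 * L) * (2 * K * (1 + sqrt ?w))"
      using bounds(1)[OF False] SC by linarith
    then have "(real (card S))\<^sup>2 \<le> ((1 + 9 * L) * (2 * K * (1 + sqrt ?w)))\<^sup>2" by (intro power_mono) auto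
    also have "\<dots> = (1 + 9 * L)\<^sup>2 * (4 * K\<^sup>2 * (1 + sqrt ?w)\<^sup>2)" by (simp add: power_mult_distrib)
    \<comment> \<open>The bound \<open>82 = 1 + 81\<close> comes from Cauchy--Schwarz, and
      \<open>656 = 82 * 4 * 2\<close>.\<close>
    also have "\<dots> \<le> (82 * (1 + L\<^sup>2)) * (4 * K\<^sup>2 * (2 * (1 + ?w)))"
    proof (intro mult_mono)
      have "0 \<le> (9 - L)\<^sup>2" by simp
      then show "(1 + 9 * L)\<^sup>2 \<le> 82 * (1 + L\<^sup>2)" by (simp add: power2_eq_square algebra_simps)
      have "0 \<le> (1 - sqrt ?w)\<^sup>2" by simp
      then show "(1 + sqrt ?w)\<^sup>2 \<le> 2 * (1 + ?w)" using w0 by (simp add: power2_sum power2_diff)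
    qed auto
    also have "\<dots> = 656 * (1 + L\<^sup>2) * (K\<^sup>2 * (1 + ?w))" by (simp add: algebra_simps)
    also have "\<dots> \<le> 656 * (1 + L\<^sup>2) * (real (card S) + K\<^sup>2 * (1 + ?w))" by (intro mult_left_mono) auto
    finally show ?thesis .
  qed
  moreover have "b \<le> r" using ab(2) Br by linarith
  ultimately show ?thesis using ab unfolding L2 by blast
qed

section \<open>Primitive pairs of roots\<close>

definition primitive_pair :: "int \<Rightarrow> int \<Rightarrow> int \<Rightarrow> bool" where
  "primitive_pair r k1 k2 \<longleftrightarrow> (\<forall>p. prime p \<longrightarrow> p\<^sup>2 dvd r \<longrightarrow> \<not> (p dvd k1 \<and> p dvd k2))"

lemma primitive_pair_commute: "primitive_pair r k1 k2 \<longleftrightarrow> primitive_pair r k2 k1"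
  by (auto simp: primitive_pair_def)

text \<open>The gcd \<open>c\<close> satisfies \<open>c\<^sup>2 dvd r\<close>,
  \<open>c dvd 2 * k1\<close> and, through \<open>f2 dvd 2 * k2\<close>, also
  \<open>c dvd 4 * k2\<^sup>2\<close>. An odd prime factor of \<open>c\<close> would divide both
  roots; if 8 divided \<open>c\<close>, both roots would be even and 4 would divide
  \<open>r\<close>. Primitivity excludes both cases.\<close>

lemma primitive_gcd_dvd_4:
  fixes r k1 k2 f1 f2 :: int
  assumes prim: "primitive_pair r k1 k2" and f: "f1\<^sup>2 dvd r" "f1 dvd 2 * k1" "f2 dvd 2 * k2" and f0: "f1 > 0"
  shows "gcd f1 (2 * k2 * f2) dvd 4"
proof -
  define c where "c = gcd f1 (2 * k2 * f2)"
  have c0: "c > 0" using f0 by (simp add: c_def)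
  have cf: "c dvd f1" by (simp add: c_def)
  have cr: "c\<^sup>2 dvd r" using cf f(1) by (meson dvd_power_same dvd_trans)
  have ck1: "c dvd 2 * k1" using cf f(2) dvd_trans by blast
  have "2 * k2 * f2 dvd 2 * k2 * (2 * k2)" using f(3) by (intro mult_dvd_mono) auto
  moreover have "c dvd 2 * k2 * f2" by (simp add: c_def)
  ultimately have "c dvd 2 * k2 * (2 * k2)" using dvd_trans by blast
  then have ck2: "c dvd 4 * k2\<^sup>2" by (simp add: power2_eq_square)
  have odd_case: "p = 2" if p: "prime p" "p dvd c" for p :: int
  proof (rule ccontr)
    assume "p \<noteq> 2"
    then have n2: "\<not> p dvd 2" using p(1) by (metis primes_dvd_imp_eq two_is_prime)
    then have n4: "\<not> p dvd 4" using p(1) prime_dvd_mult_iff[of p 2 2] by simp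
    have "p\<^sup>2 dvd r" using p(2) cr by (meson dvd_power_same dvd_trans)
    moreover have "p dvd k1" using p n2 ck1 by (metis dvd_trans prime_dvd_mult_iff)
    moreover have "p dvd k2" using p n4 ck2 by (metis dvd_trans prime_dvd_mult_iff prime_dvd_power)
    ultimately show False using prim p(1) by (auto simp: primitive_pair_def)
  qed
  obtain m where m: "c = 2 ^ multiplicity 2 c * m" "\<not> 2 dvd m"
    using multiplicity_decompose'[of c 2] c0 by auto
  define n where "n = multiplicity 2 c"
  have "\<bar>m\<bar> = 1"
  proof (rule ccontr)
    assume "\<bar>m\<bar> \<noteq> 1"
    then obtain p where p: "prime p" "p dvd m" using prime_factor_int[of m] by auto
    then have "p dvd c" by (metis dvd_mult m(1))
    then show False using odd_case p m(2) by auto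
  qed
  moreover have "m > 0" using m(1) c0 by (metis zero_less_mult_pos zero_less_numeral zero_less_power)
  ultimately have c: "c = 2 ^ n" using m(1) by (simp add: n_def)
  have "n \<le> 2"
  proof (rule ccontr)
    assume "\<not> n \<le> 2"
    then have "(2::int) ^ 3 dvd 2 ^ n" by (intro le_imp_power_dvd) simp
    then have 8: "8 dvd c" using c by simp
    have "8 dvd 2 * k1" "8 dvd 4 * k2\<^sup>2" using 8 ck1 ck2 dvd_trans by blast+
    then have "2 * 4 dvd 2 * k1" "4 * 2 dvd 4 * k2\<^sup>2" by simp_all
    then have "4 dvd k1" "2 dvd k2\<^sup>2" by (simp_all only: dvd_mult_cancel_left) simp_all
    then have "2 dvd k1" "2 dvd k2" by (presburger, simp)
    moreover have "2\<^sup>2 dvd r"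
    proof -
      have "2 dvd c" using 8 by presburger
      then show ?thesis using cr by (meson dvd_power_same dvd_trans)
    qed
    ultimately show False using prim two_is_prime by (auto simp: primitive_pair_def)
  qed
  then have "(2::int) ^ n dvd 2 ^ 2" by (rule le_imp_power_dvd)
  then show ?thesis using c by (simp add: c_def)
qed

lemma card_dvd_4_spaced_le:
  fixes A :: "int set"
  assumes r: "r > 0" and A: "A \<subseteq> {0..<r}" and dv: "\<And>x y. x \<in> A \<Longrightarrow> y \<in> A \<Longrightarrow> r dvd 4 * (x - y)"
  shows "card A \<le> 4"
proof -
  \<comment> \<open>The spacing lemma requires a divisor of \<open>r\<close>, so 4 is replaced by
    \<open>gcd 4 r\<close>.\<close>
  have "int (card A) \<le> gcd 4 r"
  proof (rule card_spaced_residues_le[OF A])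
    show "r dvd gcd 4 r * (x - y)" if "x \<in> A" "y \<in> A" for x y
      using dv[OF that] by (intro dvd_gcd_mult) auto
  qed (use r in auto)
  also have "gcd 4 r \<le> 4" by (intro zdvd_imp_le) auto
  finally show ?thesis by simp
qed

text \<open>Knowing \<open>2 * k1 * k2\<close> modulo \<open>r\<close> supplies a second multiplier,
  \<open>2 * k2' * f2\<close>, that sends \<open>k1 - k1'\<close> to 0 modulo \<open>r\<close>. The
  gcd of the two multipliers divides 4 by primitivity, whereas \<open>f1\<close> alone may be
  large.\<close>

lemma primitive_diff_dvd:
  fixes r k1 k2 k1' k2' f1 f2 :: int
  assumes prim: "primitive_pair r k1' k2'"
    and f: "f1 > 0" "f1\<^sup>2 dvd r" "f1 dvd 2 * k1'" "f2 dvd 2 * k2'"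
    and d: "r dvd f1 * (k1 - k1')" "r dvd f2 * (k2 - k2')"
    and e: "r dvd 2 * (k1 * k2 - k1' * k2')"
  shows "r dvd 4 * (k1 - k1')"
proof -
  have "2 * k2' * f2 * (k1 - k1') = f2 * (2 * (k1 * k2 - k1' * k2')) - 2 * k1 * (f2 * (k2 - k2'))"
    by (simp add: algebra_simps)
  also have "r dvd \<dots>" using d(2) e by (intro dvd_diff) auto
  finally have "r dvd gcd f1 (2 * k2' * f2) * (k1 - k1')" using d(1) by (intro dvd_gcd_mult)
  moreover have "gcd f1 (2 * k2' * f2) * (k1 - k1') dvd 4 * (k1 - k1')"
    using primitive_gcd_dvd_4[OF prim f(2-4,1)] by (rule mult_dvd_mono) simp
  ultimately show ?thesis by (rule dvd_trans)
qed

text \<open>The three squares determine the symmetric matrix \<open>v v\<^sup>T\<close> of \<open>v = (k1, k2)\<close>,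
  and for primitive \<open>v\<close> this leaves few choices for \<open>v\<close>.\<close>

lemma card_primitive_sqroot_pairs_le:
  fixes r c1 c2 c3 :: int
  assumes r: "r > 0"
  shows "card {(k1, k2). k1 \<in> sqroots r c1 \<and> k2 \<in> sqroots r c2 \<and> r dvd (k1 - k2)\<^sup>2 - c3 \<and> primitive_pair r k1 k2}
           \<le> 16 * (ndiv r)\<^sup>2" (is "card ?A \<le> _")
proof (cases "?A = {}")
  case True
  then show ?thesis by (simp only: True card.empty)
next
  case False
  then obtain a1 a2 where a: "(a1, a2) \<in> ?A" by auto
  have fin: "finite ?A" by (rule finite_subset[of _ "sqroots r c1 \<times> sqroots r c2"]) auto
  let ?D = "{d. 0 < d \<and> d dvd r}"
  have sq1: "r dvd (fst p)\<^sup>2 - a1\<^sup>2" and sq2: "r dvd (snd p)\<^sup>2 - a2\<^sup>2" if "p \<in> ?A" for p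
  proof -
    have "r dvd (fst p)\<^sup>2 - c1" "r dvd a1\<^sup>2 - c1" "r dvd (snd p)\<^sup>2 - c2" "r dvd a2\<^sup>2 - c2"
      using that a by (auto simp: sqroots_def)
    then have "r dvd ((fst p)\<^sup>2 - c1) - (a1\<^sup>2 - c1)" "r dvd ((snd p)\<^sup>2 - c2) - (a2\<^sup>2 - c2)" by (blast intro: dvd_diff)+
    then show "r dvd (fst p)\<^sup>2 - a1\<^sup>2" "r dvd (snd p)\<^sup>2 - a2\<^sup>2" by simp_all
  qed
  have "real (card ?A) \<le> real (card (?D \<times> ?D)) * 16"
  proof (rule card_le_fibers[where g = "\<lambda>p. (gcd r (fst p - a1), gcd r (snd p - a2))"])
    fix uv :: "int \<times> int"
    obtain u v where uv: "uv = (u, v)" by fastforce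
    let ?F = "{p \<in> ?A. (gcd r (fst p - a1), gcd r (snd p - a2)) = uv}"
    have key: "r dvd 4 * (fst p - fst q) \<and> r dvd 4 * (snd p - snd q)" if "p \<in> ?F" "q \<in> ?F" for p q
    proof -
      have p: "p \<in> ?A" "gcd r (fst p - a1) = u" "gcd r (snd p - a2) = v"
        and q: "q \<in> ?A" "gcd r (fst q - a1) = u" "gcd r (snd q - a2) = v" using that uv by auto
      have uvr: "u dvd r" "v dvd r" using p by auto
      define f1 f2 where "f1 = overlap r u" and "f2 = overlap r v"
      have f: "f1 > 0" "f1\<^sup>2 dvd r" "f2 > 0" "f2\<^sup>2 dvd r"
        using overlap_props[OF r uvr(1)] overlap_props[OF r uvr(2)] by (simp_all add: f1_def f2_def)
      have fq: "f1 dvd 2 * fst q" "f2 dvd 2 * snd q"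
        using overlap_dvd_twice(1)[OF r sq1[OF q(1)] q(2)] overlap_dvd_twice(1)[OF r sq2[OF q(1)] q(3)]
        by (simp_all add: f1_def f2_def)
      have d: "r dvd f1 * (fst p - fst q)" "r dvd f2 * (snd p - snd q)"
        using same_gcd_dvd[OF r sq1[OF p(1)] p(2) sq1[OF q(1)] q(2)] same_gcd_dvd[OF r sq2[OF p(1)] p(3) sq2[OF q(1)] q(3)]
        by (simp_all add: f1_def f2_def)
      have diff: "r dvd (fst p)\<^sup>2 - (fst q)\<^sup>2" "r dvd (snd p)\<^sup>2 - (snd q)\<^sup>2"
        using dvd_diff[OF sq1[OF p(1)] sq1[OF q(1)]] dvd_diff[OF sq2[OF p(1)] sq2[OF q(1)]] by simp_all
      have "r dvd (fst p - snd p)\<^sup>2 - c3" "r dvd (fst q - snd q)\<^sup>2 - c3" using p(1) q(1) by auto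
      from dvd_diff[OF this] have c3: "r dvd (fst p - snd p)\<^sup>2 - (fst q - snd q)\<^sup>2" by simp
      \<comment> \<open>Polarization: the squares of \<open>k1\<close>, \<open>k2\<close> and
        \<open>k1 - k2\<close> determine twice the product \<open>k1 * k2\<close>.\<close>
      have "2 * (fst p * snd p - fst q * snd q) = ((fst p)\<^sup>2 - (fst q)\<^sup>2) + ((snd p)\<^sup>2 - (snd q)\<^sup>2) - ((fst p - snd p)\<^sup>2 - (fst q - snd q)\<^sup>2)"
        by (simp add: power2_eq_square algebra_simps)
      also have "r dvd \<dots>" by (rule dvd_diff[OF dvd_add[OF diff] c3])
      finally have e: "r dvd 2 * (fst p * snd p - fst q * snd q)" .
      have pr: "primitive_pair r (fst q) (snd q)" using q(1) by auto
      have "r dvd 4 * (fst p - fst q)" by (rule primitive_diff_dvd[OF pr f(1,2) fq d e])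
      moreover have "r dvd 4 * (snd p - snd q)"
        using primitive_diff_dvd[OF _ f(3,4) fq(2,1) d(2,1)] pr e by (simp add: primitive_pair_commute mult.commute)
      ultimately show ?thesis ..
    qed
    have finF: "finite ?F" using fin by simp
    have "card (fst ` ?F) \<le> 4" "card (snd ` ?F) \<le> 4"
    proof -
      show "card (fst ` ?F) \<le> 4"
      proof (rule card_dvd_4_spaced_le[OF r])
        show "fst ` ?F \<subseteq> {0..<r}" by (auto simp: sqroots_def)
        show "r dvd 4 * (x - y)" if "x \<in> fst ` ?F" "y \<in> fst ` ?F" for x y using that key by blast
      qed
      show "card (snd ` ?F) \<le> 4"
      proof (rule card_dvd_4_spaced_le[OF r])
        show "snd ` ?F \<subseteq> {0..<r}" by (auto simp: sqroots_def)
        show "r dvd 4 * (x - y)" if "x \<in> snd ` ?F" "y \<in> snd ` ?F" for x y using that key by blast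
      qed
    qed
    then have "card (fst ` ?F) * card (snd ` ?F) \<le> 4 * 4" by (intro mult_mono) auto
    moreover have "card ?F \<le> card (fst ` ?F \<times> snd ` ?F)"
      using finF by (intro card_mono subsetI finite_cartesian_product finite_imageI mem_Times_iff[THEN iffD2] conjI imageI)
    ultimately have "card ?F \<le> 16" by (simp add: card_cartesian_product)
    then show "real (card ?F) \<le> 16" by linarith
  next
    show "finite (?D \<times> ?D)" using r by simp
    show "(\<lambda>p. (gcd r (fst p - a1), gcd r (snd p - a2))) ` ?A \<subseteq> ?D \<times> ?D" using r by (intro image_subsetI) simp
  qed (fact fin)
  then have "real (card ?A) \<le> real (16 * (ndiv r)\<^sup>2)"
    by (simp add: card_cartesian_product ndiv_def power2_eq_square)
  then show ?thesis by (simp only: of_nat_le_iff)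
qed

section \<open>From the energy of primitive pairs to conic points\<close>

lemma card_equal_value_pairs:
  assumes fin: "finite A" "finite B" and B: "f ` A \<subseteq> B"
  shows "card {(p, q). p \<in> A \<and> q \<in> A \<and> f p = f q} = (\<Sum>x\<in>B. (card {p \<in> A. f p = x})\<^sup>2)"
proof -
  let ?E = "{(p, q). p \<in> A \<and> q \<in> A \<and> f p = f q}"
  have finE: "finite ?E" by (rule finite_subset[of _ "A \<times> A"]) (use fin in auto)
  have "card ?E = (\<Sum>x\<in>B. card {pq \<in> ?E. f (fst pq) = x})"
    by (rule card_eq_sum_fibers[OF finE fin(2)]) (use B in auto)
  also have "\<dots> = (\<Sum>x\<in>B. (card {p \<in> A. f p = x})\<^sup>2)"
  proof (rule sum.cong[OF refl])
    fix x
    have "{pq \<in> ?E. f (fst pq) = x} = {p \<in> A. f p = x} \<times> {p \<in> A. f p = x}" by auto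
    then show "card {pq \<in> ?E. f (fst pq) = x} = (card {p \<in> A. f p = x})\<^sup>2"
      by (simp add: card_cartesian_product power2_eq_square)
  qed
  finally show ?thesis .
qed

text \<open>Multiplied by \<open>j\<^sup>2\<close>, the form becomes an expression in the roots that
  vanishes identically: apart from the factor \<open>(k1 - k2)\<^sup>2\<close> it is the
  parallelogram law. Coprimality then removes \<open>j\<^sup>2\<close>.\<close>

lemma conic_equation:
  fixes r j m1 m2 k1 k2 x :: int
  assumes k: "r dvd k1\<^sup>2 - j * m1" "r dvd k2\<^sup>2 - j * m2" "r dvd (k1 - k2)\<^sup>2 - j * x" and j: "coprime r j"
  shows "r dvd (m1 - m2)\<^sup>2 - x * (2 * (m1 + m2)) + x\<^sup>2"
proof -
  have c: "[j * m1 = k1\<^sup>2] (mod r)" "[j * m2 = k2\<^sup>2] (mod r)" "[j * x = (k1 - k2)\<^sup>2] (mod r)"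
    using k by (simp_all add: cong_iff_dvd_diff dvd_diff_commute)
  let ?G = "(m1 - m2)\<^sup>2 - x * (2 * (m1 + m2)) + x\<^sup>2"
  have "j\<^sup>2 * ?G = (j * m1 - j * m2)\<^sup>2 - (j * x) * (2 * (j * m1 + j * m2)) + (j * x)\<^sup>2"
    by (simp add: power2_eq_square algebra_simps)
  also have "[\<dots> = (k1\<^sup>2 - k2\<^sup>2)\<^sup>2 - (k1 - k2)\<^sup>2 * (2 * (k1\<^sup>2 + k2\<^sup>2)) + ((k1 - k2)\<^sup>2)\<^sup>2] (mod r)"
    by (intro cong_add cong_diff cong_mult cong_pow c cong_refl)
  also have "(k1\<^sup>2 - k2\<^sup>2)\<^sup>2 - (k1 - k2)\<^sup>2 * (2 * (k1\<^sup>2 + k2\<^sup>2)) + ((k1 - k2)\<^sup>2)\<^sup>2 = 0"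
    by (simp add: power2_eq_square algebra_simps)
  finally have "r dvd j\<^sup>2 * ?G" by (simp add: cong_0_iff)
  moreover have "coprime r (j\<^sup>2)" using j by simp
  ultimately show ?thesis using coprime_dvd_mult_right_iff by blast
qed

definition root_diff :: "int \<times> int \<times> int \<times> int \<Rightarrow> int" where
  "root_diff = (\<lambda>(m1, m2, k1, k2). k1 - k2)"

definition primitive_sqroot_pairs :: "int \<Rightarrow> int \<Rightarrow> real \<Rightarrow> real \<Rightarrow> (int \<times> int \<times> int \<times> int) set" where
  "primitive_sqroot_pairs r j M H = {(m1, m2, k1, k2) \<in> sqroot_pairs r j M H. primitive_pair r k1 k2}"

lemma primitive_sqroot_pairs_subset: "primitive_sqroot_pairs r j M H \<subseteq> sqroot_pairs r j M H"
  by (auto simp: primitive_sqroot_pairs_def)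

definition conic_point :: "int \<times> int \<times> int \<times> int \<Rightarrow> int \<times> int" where
  "conic_point = (\<lambda>(m1, m2, k1, k2). (m1 - m2, 2 * (m1 + m2)))"

lemma conic_point_mem:
  assumes p: "p \<in> sqroot_pairs r j M H" and x: "r dvd (root_diff p)\<^sup>2 - j * x" and j: "coprime r j"
  shows "conic_point p \<in> conic_points r x H (4 * M)"
proof -
  obtain m1 m2 k1 k2 where pe: "p = (m1, m2, k1, k2)" by (rule prod_cases4)
  have m: "1 \<le> m1" "m1 \<le> \<lfloor>M\<rfloor>" "1 \<le> m2" "m2 \<le> \<lfloor>M\<rfloor>" "near_distinct H m1 m2"
    "r dvd k1\<^sup>2 - j * m1" "r dvd k2\<^sup>2 - j * m2" "r dvd (k1 - k2)\<^sup>2 - j * x"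
    using p x by (auto simp: pe sqroot_pairs_def sqroots_def root_diff_def)
  have "real_of_int m1 \<le> M" "real_of_int m2 \<le> M" using m(2,4) by (simp_all add: le_floor_iff)
  then have "real_of_int (2 * (m1 + m2)) \<le> 4 * M" by simp
  then show ?thesis
    using m conic_equation[OF m(6-8) j] by (auto simp: pe conic_point_def conic_points_def near_distinct_def)
qed

text \<open>The conic point determines \<open>m1\<close> and \<open>m2\<close>, so the squares of
  \<open>k1\<close>, \<open>k2\<close> and \<open>k1 - k2\<close> are all prescribed modulo
  \<open>r\<close>, and \<open>card_primitive_sqroot_pairs_le\<close> bounds the choices of the
  roots.\<close>

lemma card_primitive_fiber_le:
  fixes r j x :: int
  assumes r: "r > 0"
    and A: "A \<subseteq> {p \<in> primitive_sqroot_pairs r j M H. r dvd (root_diff p)\<^sup>2 - j * x}"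
  shows "real (card A) \<le> real (card (conic_point ` A)) * (16 * (real (ndiv r))\<^sup>2)"
proof (rule card_le_fibers[where g = conic_point])
  show finA: "finite A"
  proof (rule finite_subset)
    show "A \<subseteq> sqroot_pairs r j M H" using A primitive_sqroot_pairs_subset[of r j M H] by blast
  qed simp
  then show "finite (conic_point ` A)" by simp
  fix c assume "c \<in> conic_point ` A"
  then obtain m1 m2 l1 l2 where c: "c = conic_point (m1, m2, l1, l2)" by (metis imageE prod_cases4)
  let ?F = "{p \<in> A. conic_point p = c}"
  let ?T = "{(k1, k2). k1 \<in> sqroots r (j * m1) \<and> k2 \<in> sqroots r (j * m2) \<and> r dvd (k1 - k2)\<^sup>2 - j * x \<and> primitive_pair r k1 k2}"
  have finT: "finite ?T" by (rule finite_subset[of _ "sqroots r (j * m1) \<times> sqroots r (j * m2)"]) auto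
  have m: "fst p = m1 \<and> fst (snd p) = m2" if "p \<in> ?F" for p
    using that c by (cases p rule: prod_cases4) (auto simp: conic_point_def)
  have "card ?F \<le> card ?T"
  proof (rule card_inj_on_le[OF _ _ finT])
    show "inj_on (\<lambda>p. snd (snd p)) ?F"
    proof (rule inj_onI)
      fix p q assume "p \<in> ?F" "q \<in> ?F" "snd (snd p) = snd (snd q)"
      then show "p = q" using m[of p] m[of q] by (simp add: prod_eq_iff)
    qed
    show "(\<lambda>p. snd (snd p)) ` ?F \<subseteq> ?T"
    proof (rule image_subsetI)
      fix p assume p: "p \<in> ?F"
      obtain a1 a2 k1 k2 where pe: "p = (a1, a2, k1, k2)" by (rule prod_cases4)
      have "a1 = m1" "a2 = m2" using m[OF p] pe by auto
      moreover have "p \<in> primitive_sqroot_pairs r j M H" "r dvd (root_diff p)\<^sup>2 - j * x" using p A by auto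
      ultimately show "snd (snd p) \<in> ?T"
        by (auto simp: pe primitive_sqroot_pairs_def sqroot_pairs_def root_diff_def)
    qed
  qed
  also have "\<dots> \<le> 16 * (ndiv r)\<^sup>2" by (rule card_primitive_sqroot_pairs_le[OF r])
  finally have "real (card ?F) \<le> real (16 * (ndiv r)\<^sup>2)" by (simp only: of_nat_le_iff)
  then show "real (card ?F) \<le> 16 * (real (ndiv r))\<^sup>2" by simp
qed simp

text \<open>The pairs are grouped by the residue \<open>x\<close> of the squared difference over
  \<open>j\<close>, and each group is replaced by its set \<open>S\<close> of conic points. In the
  sum of the squared sizes of \<open>S\<close>, the terms \<open>card S\<close> and 1 are controlled
  by the number of pairs and the weights by their average over \<open>x\<close>. The parameter
  \<open>Q\<close> majorizes all divisor counts and harmonic sums that occur.\<close>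

lemma primitive_energy_le:
  fixes r j :: int and H M Q :: real
  assumes r: "r > 0" and j: "coprime r j" and H: "1 \<le> H" "H \<le> M" and M: "M \<le> r"
    and Q: "\<And>n. 0 < n \<Longrightarrow> n \<le> r \<Longrightarrow> real (ndiv n) \<le> Q \<and> recip_sum n \<le> Q"
  shows "real (card {(p, q). p \<in> primitive_sqroot_pairs r j M H \<and> q \<in> primitive_sqroot_pairs r j M H \<and>
                              [root_diff p = root_diff q] (mod r)})
         \<le> 5373952 * Q ^ 11 * (H * M * (1 + H\<^sup>2 * M / r))"
proof -
  let ?P = "primitive_sqroot_pairs r j M H"
  have fin: "finite ?P" by (rule finite_subset[OF primitive_sqroot_pairs_subset]) simp
  have K: "real (ndiv n) \<le> Q" if "0 < n" "n \<le> r" for n using Q[OF that] by simp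
  have Kr: "real (ndiv r) \<le> Q" and Lr: "recip_sum r \<le> Q" using Q[of r] r by auto
  have Q1: "Q \<ge> 1" using K[of 1] ndiv_pos[of 1] r by simp
  obtain j' where j': "[j * j' = 1] (mod r)" using j by (metis cong_solve_coprime_int coprime_commute)
  define x where "x p = ((root_diff p)\<^sup>2 * j') mod r" for p
  have xd: "r dvd (root_diff p)\<^sup>2 - j * x p" for p
  proof -
    have "[j * x p = j * ((root_diff p)\<^sup>2 * j')] (mod r)" unfolding x_def by (intro cong_scalar_left) simp
    also have "j * ((root_diff p)\<^sup>2 * j') = (root_diff p)\<^sup>2 * (j * j')" by simp
    also have "[\<dots> = (root_diff p)\<^sup>2 * 1] (mod r)" by (intro cong_scalar_left j')
    finally show ?thesis by (simp add: cong_iff_dvd_diff dvd_diff_commute)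
  qed
  define X where "X = x ` ?P"
  define F where "F y = {p \<in> ?P. x p = y}" for y
  define S where "S y = conic_point ` F y" for y
  have finX: "finite X" using fin by (simp add: X_def)
  have finF: "finite (F y)" for y using fin by (simp add: F_def)
  have X_sub: "X \<subseteq> {0..<r}" using r by (auto simp: X_def x_def)
  have S_sub: "S y \<subseteq> conic_points r y H (4 * M)" for y
  proof -
    have "conic_point p \<in> conic_points r y H (4 * M)" if "p \<in> F y" for p
      using conic_point_mem[of p r j M H y] that xd[of p] j subsetD[OF primitive_sqroot_pairs_subset, of p]
      by (auto simp: F_def)
    then show ?thesis by (auto simp: S_def)
  qed
  have NS: "real (card (F y)) \<le> real (card (S y)) * (16 * Q\<^sup>2)" for y
  proof -
    have "F y \<subseteq> {p \<in> ?P. r dvd (root_diff p)\<^sup>2 - j * y}" using xd by (auto simp: F_def)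
    then have "real (card (F y)) \<le> real (card (S y)) * (16 * (real (ndiv r))\<^sup>2)"
      unfolding S_def by (rule card_primitive_fiber_le[OF r])
    also have "\<dots> \<le> real (card (S y)) * (16 * Q\<^sup>2)" using Kr by (intro mult_left_mono power_mono) auto
    finally show ?thesis .
  qed
  have cardP: "real (card ?P) \<le> 8 * H * M * Q ^ 3"
  proof -
    have "real (card ?P) \<le> real (card (sqroot_pairs r j M H))"
      using card_mono[OF finite_sqroot_pairs primitive_sqroot_pairs_subset] by simp
    also have "\<dots> \<le> 8 * H * M * (real (ndiv r)) ^ 3" using H by (intro card_sqroot_pairs_le[OF r j]) auto
    also have "\<dots> \<le> 8 * H * M * Q ^ 3" using Kr H by (intro mult_left_mono power_mono) auto
    finally show ?thesis .
  qed
  have sumF: "(\<Sum>y\<in>X. real (card (F y))) = real (card ?P)"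
    using card_eq_sum_fibers[OF fin finX, of x] by (simp add: X_def F_def)
  have sumS: "(\<Sum>y\<in>X. real (card (S y))) \<le> real (card ?P)"
    unfolding sumF[symmetric] S_def by (intro sum_mono) (simp add: card_image_le finF)
  have cardX: "real (card X) \<le> real (card ?P)" unfolding X_def by (simp add: card_image_le fin)
  have "\<forall>y. \<exists>a b. 1 \<le> b \<and> b \<le> r \<and> \<bar>a\<bar> \<le> r \<and> r dvd a - y * b \<and>
    (real (card (S y)))\<^sup>2 \<le> 656 * (1 + H\<^sup>2 * M / r) * (real (card (S y)) + Q\<^sup>2 * (1 + conic_weight H (4 * M) a b))"
    using conic_points_sq_bound[OF r H M K S_sub] by blast
  then obtain a b where ab: "\<And>y. 1 \<le> b y \<and> b y \<le> r \<and> \<bar>a y\<bar> \<le> r \<and> r dvd a y - y * b y"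
    and S2: "\<And>y. (real (card (S y)))\<^sup>2 \<le> 656 * (1 + H\<^sup>2 * M / r) * (real (card (S y)) + Q\<^sup>2 * (1 + conic_weight H (4 * M) (a y) (b y)))"
    by metis
  have W: "(\<Sum>y\<in>X. conic_weight H (4 * M) (a y) (b y)) \<le> 16 * H * M * Q ^ 3"
  proof -
    have "(\<Sum>y\<in>X. conic_weight H (4 * M) (a y) (b y)) \<le> 4 * H * (4 * M) * ndiv r * (recip_sum r)\<^sup>2"
      using H by (intro sum_conic_weight_le[OF r _ _ X_sub] ab) auto
    also have "\<dots> \<le> 4 * H * (4 * M) * Q * Q\<^sup>2"
      using H Kr Lr Q1 recip_sum_nonneg[of r] by (intro mult_mono power_mono mult_left_mono) auto
    finally show ?thesis by (simp add: power2_eq_square power3_eq_cube mult_ac)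
  qed
  have HM: "H * M \<ge> 0" using H by simp
  let ?L = "1 + H\<^sup>2 * M / r"
  have L0: "?L \<ge> 0" using H r by simp
  have "(\<Sum>y\<in>X. (real (card (S y)))\<^sup>2)
      \<le> (\<Sum>y\<in>X. 656 * ?L * (real (card (S y)) + Q\<^sup>2 * (1 + conic_weight H (4 * M) (a y) (b y))))"
    by (intro sum_mono S2)
  also have "\<dots> = 656 * ?L * ((\<Sum>y\<in>X. real (card (S y))) + Q\<^sup>2 * (real (card X) + (\<Sum>y\<in>X. conic_weight H (4 * M) (a y) (b y))))"
    by (simp add: sum_distrib_left[symmetric] sum.distrib)
  also have "\<dots> \<le> 656 * ?L * (8 * H * M * Q ^ 3 + Q\<^sup>2 * (8 * H * M * Q ^ 3 + 16 * H * M * Q ^ 3))"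
    using sumS cardX cardP W L0 by (intro mult_left_mono add_mono) auto
  also have "\<dots> \<le> 656 * ?L * (32 * (H * M) * Q ^ 5)"
  proof (rule mult_left_mono)
    have "Q ^ 3 \<le> Q ^ 5" using Q1 by (intro power_increasing) auto
    then have "8 * (H * M) * Q ^ 3 \<le> 8 * (H * M) * Q ^ 5" using HM by (intro mult_left_mono) auto
    then have A: "8 * H * M * Q ^ 3 \<le> 8 * (H * M) * Q ^ 5" by (simp only: mult.assoc)
    have B: "Q\<^sup>2 * (8 * H * M * Q ^ 3 + 16 * H * M * Q ^ 3) = 24 * (H * M) * Q ^ 5"
      by (simp add: power_numeral_reduce algebra_simps)
    have C: "32 * (H * M) * Q ^ 5 = 8 * (H * M) * Q ^ 5 + 24 * (H * M) * Q ^ 5" by simp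
    show "8 * H * M * Q ^ 3 + Q\<^sup>2 * (8 * H * M * Q ^ 3 + 16 * H * M * Q ^ 3) \<le> 32 * (H * M) * Q ^ 5"
      unfolding B C using A by (rule add_right_mono)
  qed (use L0 in simp)
  finally have sumS2: "(\<Sum>y\<in>X. (real (card (S y)))\<^sup>2) \<le> 656 * ?L * (32 * (H * M) * Q ^ 5)" .
  \<comment> \<open>Congruent differences give equal \<open>x\<close>. The converse need not hold,
    for instance for opposite differences, so passing to \<open>x\<close> only enlarges the
    count.\<close>
  have "{(p, q). p \<in> ?P \<and> q \<in> ?P \<and> [root_diff p = root_diff q] (mod r)} \<subseteq> {(p, q). p \<in> ?P \<and> q \<in> ?P \<and> x p = x q}"
  proof clarify
    fix p q assume "[root_diff p = root_diff q] (mod r)"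
    then have "[(root_diff p)\<^sup>2 * j' = (root_diff q)\<^sup>2 * j'] (mod r)" by (intro cong_mult cong_pow cong_refl)
    then show "x p = x q" by (simp add: x_def unique_euclidean_semiring_class.cong_def)
  qed
  moreover have "finite {(p, q). p \<in> ?P \<and> q \<in> ?P \<and> x p = x q}"
    by (rule finite_subset[of _ "?P \<times> ?P"]) (use fin in auto)
  ultimately have "card {(p, q). p \<in> ?P \<and> q \<in> ?P \<and> [root_diff p = root_diff q] (mod r)}
                 \<le> card {(p, q). p \<in> ?P \<and> q \<in> ?P \<and> x p = x q}"
    by (rule card_mono[rotated])
  also have "\<dots> = (\<Sum>y\<in>X. (card (F y))\<^sup>2)"
    unfolding X_def F_def by (rule card_equal_value_pairs) (use fin in simp_all)
  finally have "real (card {(p, q). p \<in> ?P \<and> q \<in> ?P \<and> [root_diff p = root_diff q] (mod r)})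
     \<le> real (\<Sum>y\<in>X. (card (F y))\<^sup>2)" by (simp only: of_nat_le_iff)
  also have "\<dots> = (\<Sum>y\<in>X. (real (card (F y)))\<^sup>2)" by simp
  also have "\<dots> \<le> (\<Sum>y\<in>X. 256 * Q ^ 4 * (real (card (S y)))\<^sup>2)"
  proof (rule sum_mono)
    fix y
    have "(real (card (F y)))\<^sup>2 \<le> (real (card (S y)) * (16 * Q\<^sup>2))\<^sup>2" by (intro power_mono NS) auto
    then show "(real (card (F y)))\<^sup>2 \<le> 256 * Q ^ 4 * (real (card (S y)))\<^sup>2"
      by (simp add: power_mult_distrib mult_ac)
  qed
  also have "\<dots> = 256 * Q ^ 4 * (\<Sum>y\<in>X. (real (card (S y)))\<^sup>2)" by (simp add: sum_distrib_left)
  also have "\<dots> \<le> 256 * Q ^ 4 * (656 * ?L * (32 * (H * M) * Q ^ 5))"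
    using sumS2 Q1 by (intro mult_left_mono) auto
  \<comment> \<open>The constant is \<open>256 * 656 * 32\<close>, where 256 is the square of the
    bound 16 for the roots over a conic point.\<close>
  also have "\<dots> = 5373952 * Q ^ 9 * (H * M * ?L)" by (simp add: power_numeral_reduce mult_ac)
  also have "\<dots> \<le> 5373952 * Q ^ 11 * (H * M * ?L)"
    using Q1 HM L0 by (intro mult_right_mono mult_left_mono power_increasing) auto
  finally show ?thesis .
qed

section \<open>Removing the common content\<close>

definition common_content :: "int \<Rightarrow> int \<Rightarrow> int \<Rightarrow> int" where
  "common_content r k1 k2 = Max {g. 0 < g \<and> g\<^sup>2 dvd r \<and> g dvd k1 \<and> g dvd k2}"

lemma common_content_props:
  fixes r k1 k2 :: int
  assumes r: "r > 0"
  defines "g \<equiv> common_content r k1 k2"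
  shows "0 < g" "g\<^sup>2 dvd r" "g dvd k1" "g dvd k2"
    and "\<And>h. 0 < h \<Longrightarrow> h\<^sup>2 dvd r \<Longrightarrow> h dvd k1 \<Longrightarrow> h dvd k2 \<Longrightarrow> h \<le> g"
proof -
  let ?G = "{g. 0 < g \<and> g\<^sup>2 dvd r \<and> g dvd k1 \<and> g dvd k2}"
  have "?G \<subseteq> {0..r}"
  proof clarsimp
    fix h :: int assume h: "0 < h" "h\<^sup>2 dvd r"
    then have "h dvd r" by (simp add: power2_eq_square dvd_mult_left)
    then show "h \<le> r" using r by (intro zdvd_imp_le)
  qed
  then have fin: "finite ?G" by (rule finite_subset) simp
  have "1 \<in> ?G" by simp
  then have "Max ?G \<in> ?G" by (intro Max_in[OF fin]) blast
  then show "0 < g" "g\<^sup>2 dvd r" "g dvd k1" "g dvd k2" by (auto simp: g_def common_content_def)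
  show "h \<le> g" if "0 < h" "h\<^sup>2 dvd r" "h dvd k1" "h dvd k2" for h
    unfolding g_def common_content_def using fin that by (intro Max_ge) auto
qed

text \<open>On the pairs of content \<open>g\<close> the quotient \<open>k div g\<close> ranges
  below \<open>r / g\<close>. It is reduced modulo \<open>r div g\<^sup>2\<close> to be a
  representative for the smaller modulus, so up to \<open>g\<close> values of each root
  merge.\<close>

definition divide_content :: "int \<Rightarrow> int \<Rightarrow> int \<times> int \<times> int \<times> int \<Rightarrow> int \<times> int \<times> int \<times> int" where
  "divide_content r g = (\<lambda>(m1, m2, k1, k2). (m1 div g\<^sup>2, m2 div g\<^sup>2, (k1 div g) mod (r div g\<^sup>2), (k2 div g) mod (r div g\<^sup>2)))"

definition content_pairs :: "int \<Rightarrow> int \<Rightarrow> real \<Rightarrow> real \<Rightarrow> int \<Rightarrow> (int \<times> int \<times> int \<times> int) set" where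
  "content_pairs r j M H g = {(m1, m2, k1, k2) \<in> sqroot_pairs r j M H. common_content r k1 k2 = g}"

lemma sq_dvd_radicand:
  fixes r g j m k :: int
  assumes "coprime r j" "g\<^sup>2 dvd r" "g dvd k" "r dvd k\<^sup>2 - j * m"
  shows "g\<^sup>2 dvd m"
proof -
  have "g\<^sup>2 dvd k\<^sup>2" using assms(3) by (rule dvd_power_same)
  moreover have "g\<^sup>2 dvd k\<^sup>2 - j * m" using assms(2,4) dvd_trans by blast
  ultimately have "g\<^sup>2 dvd k\<^sup>2 - (k\<^sup>2 - j * m)" by (rule dvd_diff)
  then have "g\<^sup>2 dvd j * m" by simp
  moreover have "coprime (g\<^sup>2) j" using assms(1,2) by (meson coprime_divisors dvd_refl)
  ultimately show ?thesis using coprime_dvd_mult_right_iff by blast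
qed

lemma sqroot_divide:
  fixes r g j m k :: int
  assumes r: "r > 0" and j: "coprime r j" and g: "g > 0" "g\<^sup>2 dvd r" "g dvd k" and k: "k \<in> sqroots r (j * m)"
  shows "(k div g) mod (r div g\<^sup>2) \<in> sqroots (r div g\<^sup>2) (j * (m div g\<^sup>2))"
proof -
  let ?r = "r div g\<^sup>2"
  obtain s where s: "r = g\<^sup>2 * s" using g(2) by blast
  have g2: "g\<^sup>2 > 0" using g(1) by simp
  have s0: "s > 0" using s r g2 by (simp add: zero_less_mult_iff)
  have rs: "?r = s" using s g2 by simp
  have kr: "r dvd k\<^sup>2 - j * m" using k by (simp add: sqroots_def)
  obtain n where n: "m = g\<^sup>2 * n" using sq_dvd_radicand[OF j g(2,3) kr] by blast
  obtain l where l: "k = g * l" using g(3) by blast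
  have "g\<^sup>2 * s dvd g\<^sup>2 * (l\<^sup>2 - j * n)" using kr unfolding s n l by (simp add: power_mult_distrib algebra_simps)
  then have "s dvd l\<^sup>2 - j * n" using g2 by simp
  then have "[l\<^sup>2 = j * n] (mod s)" by (simp add: cong_iff_dvd_diff)
  moreover have "[(l mod s)\<^sup>2 = l\<^sup>2] (mod s)" by (intro cong_pow) simp
  ultimately have "s dvd (l mod s)\<^sup>2 - j * n" using cong_trans by (simp add: cong_iff_dvd_diff[symmetric]) blast
  then show ?thesis using s0 g g2 by (simp add: rs n l sqroots_def)
qed

text \<open>Primitivity is maximality of \<open>g\<close>: a prime \<open>q\<close> violating it
  would make \<open>g * q\<close> an admissible larger content. Since \<open>g\<^sup>2\<close>
  divides the nonzero difference \<open>m1 - m2\<close>, the reduced range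
  \<open>H / g\<^sup>2\<close> is still at least 1, as the primitive bound requires.\<close>

lemma divide_content_mem:
  fixes r j g :: int and M H :: real
  assumes r: "r > 0" and j: "coprime r j" and p: "p \<in> content_pairs r j M H g"
  shows "divide_content r g p \<in> primitive_sqroot_pairs (r div g\<^sup>2) j (M / g\<^sup>2) (H / g\<^sup>2)"
    and "g > 0" "g\<^sup>2 dvd r" "1 \<le> H / g\<^sup>2"
proof -
  obtain m1 m2 k1 k2 where pe: "p = (m1, m2, k1, k2)" by (rule prod_cases4)
  have P: "m1 \<in> {1..\<lfloor>M\<rfloor>}" "m2 \<in> {1..\<lfloor>M\<rfloor>}" "near_distinct H m1 m2"
    and k: "k1 \<in> sqroots r (j * m1)" "k2 \<in> sqroots r (j * m2)" and gc: "common_content r k1 k2 = g"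
    using p by (auto simp: pe content_pairs_def sqroot_pairs_def)
  note cc = common_content_props[OF r, where ?k1.0 = k1 and ?k2.0 = k2, unfolded gc]
  show g0: "g > 0" and gr: "g\<^sup>2 dvd r" by (rule cc)+
  have g2: "g\<^sup>2 > 0" using g0 by simp
  obtain s where s: "r = g\<^sup>2 * s" using gr by blast
  have s0: "s > 0" using s r g2 by (simp add: zero_less_mult_iff)
  have rs: "r div g\<^sup>2 = s" using s g2 by simp
  have kr: "r dvd k1\<^sup>2 - j * m1" "r dvd k2\<^sup>2 - j * m2" using k by (auto simp: sqroots_def)
  obtain n1 n2 where n: "m1 = g\<^sup>2 * n1" "m2 = g\<^sup>2 * n2"
    using sq_dvd_radicand[OF j gr cc(3) kr(1)] sq_dvd_radicand[OF j gr cc(4) kr(2)] by (auto elim!: dvdE)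
  obtain l1 l2 where l: "k1 = g * l1" "k2 = g * l2" using cc(3,4) by (auto elim!: dvdE)
  have range: "n \<in> {1..\<lfloor>M / g\<^sup>2\<rfloor>}" if "g\<^sup>2 * n \<in> {1..\<lfloor>M\<rfloor>}" for n
  proof -
    have "real_of_int (g\<^sup>2 * n) \<le> M" using that by (simp add: le_floor_iff)
    then have "real_of_int n \<le> M / real_of_int (g\<^sup>2)" using g2 by (simp add: field_simps)
    moreover have "n > 0" using that g2 by (simp add: int_one_le_iff_zero_less zero_less_mult_iff)
    ultimately show ?thesis by (simp add: le_floor_iff)
  qed
  have md: "\<bar>m1 - m2\<bar> = g\<^sup>2 * \<bar>n1 - n2\<bar>" using n by (simp add: abs_mult flip: right_diff_distrib)
  have "\<bar>n1 - n2\<bar> > 0" using P(3) md by (auto simp: near_distinct_def)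
  moreover have nH: "real_of_int \<bar>n1 - n2\<bar> \<le> H / real_of_int (g\<^sup>2)"
  proof -
    have "real_of_int (g\<^sup>2 * \<bar>n1 - n2\<bar>) \<le> H" using P(3) md by (simp only: near_distinct_def)
    then show ?thesis using g2 by (simp add: field_simps)
  qed
  ultimately have near: "near_distinct (H / g\<^sup>2) n1 n2" by (simp add: near_distinct_def)
  have "1 \<le> real_of_int \<bar>n1 - n2\<bar>" using \<open>\<bar>n1 - n2\<bar> > 0\<close> by linarith
  then show "1 \<le> H / g\<^sup>2" using nH by linarith
  have "primitive_pair s (l1 mod s) (l2 mod s)"
    unfolding primitive_pair_def
  proof (intro allI impI notI, elim conjE)
    fix q :: int assume q: "prime q" "q\<^sup>2 dvd s" "q dvd l1 mod s" "q dvd l2 mod s"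
    have q0: "q > 1" using q(1) prime_gt_1_int by blast
    have "q dvd s" using q(2) by (simp add: power2_eq_square dvd_mult_left)
    then have "q dvd l1" "q dvd l2" using q(3,4) by (simp_all add: dvd_mod_iff)
    then have "g * q dvd k1" "g * q dvd k2" by (simp_all add: l)
    moreover have "(g * q)\<^sup>2 dvd r" unfolding s power_mult_distrib using q(2) by (intro mult_dvd_mono) auto
    ultimately have "g * q \<le> g" using cc(5)[of "g * q"] g0 q0 by simp
    then show False using g0 q0 by (simp add: mult_le_cancel_left1)
  qed
  moreover have "l1 mod s \<in> sqroots s (j * n1)" "l2 mod s \<in> sqroots s (j * n2)"
    using sqroot_divide[OF r j g0 gr cc(3) k(1)] sqroot_divide[OF r j g0 gr cc(4) k(2)] g0 g2
    by (simp_all add: rs n l)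
  ultimately show "divide_content r g p \<in> primitive_sqroot_pairs (r div g\<^sup>2) j (M / g\<^sup>2) (H / g\<^sup>2)"
    using range[of n1] range[of n2] P near g0 g2
    by (simp add: pe divide_content_def primitive_sqroot_pairs_def sqroot_pairs_def rs n l)
qed

text \<open>Both \<open>m1\<close> and \<open>m2\<close> are multiples of \<open>g\<^sup>2\<close>
  and are recovered exactly. Each root is recovered modulo \<open>r / g\<close>, which leaves at
  most \<open>g\<close> choices for it.\<close>

lemma card_divide_content_fiber_le:
  fixes r j g :: int and M H :: real
  assumes r: "r > 0" and j: "coprime r j" and g: "g > 0" "g\<^sup>2 dvd r"
  shows "real (card {p \<in> content_pairs r j M H g. divide_content r g p = q}) \<le> (real_of_int g)\<^sup>2"
proof -
  let ?F = "{p \<in> content_pairs r j M H g. divide_content r g p = q}"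
  let ?k1 = "\<lambda>p::int \<times> int \<times> int \<times> int. fst (snd (snd p))" and ?k2 = "\<lambda>p::int \<times> int \<times> int \<times> int. snd (snd (snd p))"
  obtain s where s: "r = g\<^sup>2 * s" using g(2) by blast
  have g2: "g\<^sup>2 > 0" using g(1) by simp
  have rs: "r div g\<^sup>2 = s" using s g2 by simp
  have finF: "finite ?F" by (rule finite_subset[of _ "sqroot_pairs r j M H"]) (auto simp: content_pairs_def)
  have gr: "g dvd r" using s by (simp add: power2_eq_square)
  have mem: "\<exists>m1 m2 k1 k2. p = (m1, m2, k1, k2) \<and> k1 \<in> {0..<r} \<and> k2 \<in> {0..<r} \<and> g dvd k1 \<and> g dvd k2 \<and> g\<^sup>2 dvd m1 \<and> g\<^sup>2 dvd m2"
    if "p \<in> content_pairs r j M H g" for p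
  proof -
    obtain m1 m2 k1 k2 where pe: "p = (m1, m2, k1, k2)" by (rule prod_cases4)
    have k: "k1 \<in> sqroots r (j * m1)" "k2 \<in> sqroots r (j * m2)" and gc: "common_content r k1 k2 = g"
      using that by (auto simp: pe content_pairs_def sqroot_pairs_def)
    note cc = common_content_props[OF r, where ?k1.0 = k1 and ?k2.0 = k2, unfolded gc]
    show ?thesis
      using pe k cc(3,4) sq_dvd_radicand[OF j g(2) cc(3)] sq_dvd_radicand[OF j g(2) cc(4)]
      by (auto simp: sqroots_def)
  qed
  have lift: "r dvd g * (x - y)" if "g dvd x" "g dvd y" "(x div g) mod s = (y div g) mod s" for x y
  proof -
    have "s dvd x div g - y div g" using that(3) by (simp add: mod_eq_dvd_iff)
    then have "g * (g * s) dvd g * (g * (x div g - y div g))" by (intro mult_dvd_mono) auto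
    moreover have "g * (x div g - y div g) = x - y" using that(1,2) by (simp add: right_diff_distrib)
    ultimately show ?thesis using s by (simp add: power2_eq_square mult.assoc)
  qed
  have inj: "inj_on (\<lambda>p. (?k1 p, ?k2 p)) ?F"
  proof (rule inj_onI)
    fix p p' assume p: "p \<in> ?F" and p': "p' \<in> ?F" and e: "(?k1 p, ?k2 p) = (?k1 p', ?k2 p')"
    obtain m1 m2 k1 k2 where pe: "p = (m1, m2, k1, k2)" "g\<^sup>2 dvd m1" "g\<^sup>2 dvd m2" using mem[of p] p by auto
    obtain m1' m2' k1' k2' where pe': "p' = (m1', m2', k1', k2')" "g\<^sup>2 dvd m1'" "g\<^sup>2 dvd m2'" using mem[of p'] p' by auto
    have "divide_content r g p = divide_content r g p'" using p p' by simp
    then have "m1 div g\<^sup>2 = m1' div g\<^sup>2" "m2 div g\<^sup>2 = m2' div g\<^sup>2" by (simp_all add: pe pe' divide_content_def)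
    then have "m1 = m1'" "m2 = m2'" using pe(2,3) pe'(2,3) by (metis dvd_div_mult_self)+
    then show "p = p'" using e by (simp add: pe pe')
  qed
  have same: "r dvd g * (?k1 p - ?k1 p') \<and> r dvd g * (?k2 p - ?k2 p')" if p: "p \<in> ?F" and p': "p' \<in> ?F" for p p'
  proof -
    obtain m1 m2 k1 k2 where pe: "p = (m1, m2, k1, k2)" "g dvd k1" "g dvd k2" using mem[of p] p by auto
    obtain m1' m2' k1' k2' where pe': "p' = (m1', m2', k1', k2')" "g dvd k1'" "g dvd k2'" using mem[of p'] p' by auto
    have "divide_content r g p = divide_content r g p'" using p p' by simp
    then have "(k1 div g) mod s = (k1' div g) mod s" "(k2 div g) mod s = (k2' div g) mod s"
      by (simp_all add: pe pe' divide_content_def rs)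
    then show ?thesis using lift pe pe' by simp
  qed
  have c1: "int (card (?k1 ` ?F)) \<le> g"
  proof (rule card_spaced_residues_le[OF _ g(1) gr])
    show "?k1 ` ?F \<subseteq> {0..<r}" using mem by fastforce
    show "r dvd g * (x - y)" if "x \<in> ?k1 ` ?F" "y \<in> ?k1 ` ?F" for x y using that same by blast
  qed
  have c2: "int (card (?k2 ` ?F)) \<le> g"
  proof (rule card_spaced_residues_le[OF _ g(1) gr])
    show "?k2 ` ?F \<subseteq> {0..<r}" using mem by fastforce
    show "r dvd g * (x - y)" if "x \<in> ?k2 ` ?F" "y \<in> ?k2 ` ?F" for x y using that same by blast
  qed
  have "card ?F \<le> card (?k1 ` ?F \<times> ?k2 ` ?F)"
    using finF by (intro card_inj_on_le[OF inj] image_subsetI SigmaI imageI) auto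
  also have "\<dots> = card (?k1 ` ?F) * card (?k2 ` ?F)" by (rule card_cartesian_product)
  finally have "int (card ?F) \<le> int (card (?k1 ` ?F)) * int (card (?k2 ` ?F))" by (simp only: of_nat_mult[symmetric] of_nat_le_iff)
  also have "\<dots> \<le> g * g" using c1 c2 g(1) by (intro mult_mono) auto
  finally have "real_of_int (int (card ?F)) \<le> real_of_int (g * g)" by (simp only: of_int_le_iff)
  then show ?thesis by (simp add: power2_eq_square)
qed

section \<open>Energy bounds\<close>

definition root_energy :: "int \<Rightarrow> (int \<times> int \<times> int \<times> int) set \<Rightarrow> nat" where
  "root_energy r A = card {(p, q). p \<in> A \<and> q \<in> A \<and> [root_diff p = root_diff q] (mod r)}"

lemma root_energy_eq_sum:
  assumes r: "r > 0" and fin: "finite A"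
  shows "root_energy r A = (\<Sum>y\<in>{0..<r}. (card {p \<in> A. root_diff p mod r = y})\<^sup>2)"
  unfolding root_energy_def unique_euclidean_semiring_class.cong_def
  by (rule card_equal_value_pairs) (use r fin in auto)

text \<open>A pair of reduced pairs has at most \<open>g ^ 4\<close> preimages, and this is exactly
  the factor that \<open>H * M\<close> loses when both are divided by \<open>g\<^sup>2\<close>. The
  ratio \<open>H\<^sup>2 * M / r\<close> even shrinks by \<open>g ^ 4\<close>, so the bound for
  primitive pairs persists.\<close>

lemma content_energy_le:
  fixes r j g :: int and H M Q :: real
  assumes r: "r > 0" and j: "coprime r j" and H: "1 \<le> H" "H \<le> M" and M: "M \<le> r"
    and Q: "\<And>n. 0 < n \<Longrightarrow> n \<le> r \<Longrightarrow> real (ndiv n) \<le> Q \<and> recip_sum n \<le> Q"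
  shows "real (root_energy r (content_pairs r j M H g)) \<le> 5373952 * Q ^ 11 * (H * M * (1 + H\<^sup>2 * M / r))"
proof (cases "content_pairs r j M H g = {}")
  case True
  have "Q \<ge> 0" by (rule order_trans[OF of_nat_0_le_iff[of "ndiv r"]]) (use Q[of r] r in simp)
  then show ?thesis using True H r by (simp add: root_energy_def)
next
  case False
  then obtain p0 where p0: "p0 \<in> content_pairs r j M H g" by blast
  note pr = divide_content_mem[OF r j p0]
  have g0: "g > 0" and gr: "g\<^sup>2 dvd r" and gH: "1 \<le> H / g\<^sup>2" by (rule pr)+
  have g2: "g\<^sup>2 > 0" using g0 by simp
  obtain s where s: "r = g\<^sup>2 * s" using gr by blast
  have s0: "s > 0" using s r g2 by (simp add: zero_less_mult_iff)
  have rs: "r div g\<^sup>2 = s" using s g2 by simp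
  have "1 * s \<le> g\<^sup>2 * s" using g2 s0 by (intro mult_right_mono) linarith+
  then have sr: "s \<le> r" using s by simp
  let ?C = "content_pairs r j M H g" and ?P = "primitive_sqroot_pairs s j (M / g\<^sup>2) (H / g\<^sup>2)"
  let ?\<psi> = "\<lambda>pq. (divide_content r g (fst pq), divide_content r g (snd pq))"
  let ?E = "{(p, q). p \<in> ?C \<and> q \<in> ?C \<and> [root_diff p = root_diff q] (mod r)}"
  let ?E' = "{(p, q). p \<in> ?P \<and> q \<in> ?P \<and> [root_diff p = root_diff q] (mod s)}"
  have finC: "finite ?C" by (rule finite_subset[of _ "sqroot_pairs r j M H"]) (auto simp: content_pairs_def)
  have finP: "finite ?P" by (rule finite_subset[OF primitive_sqroot_pairs_subset]) simp
  have G: "(real_of_int g)\<^sup>2 > 0" using g0 by simp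
  have rG: "real_of_int r = (real_of_int g)\<^sup>2 * s" using s by simp
  have "real (card ?E) \<le> real (card ?E') * ((real_of_int g)\<^sup>2 * (real_of_int g)\<^sup>2)"
  proof (rule card_le_fibers[where g = ?\<psi>])
    show "finite ?E" by (rule finite_subset[of _ "?C \<times> ?C"]) (use finC in auto)
    show "finite ?E'" by (rule finite_subset[of _ "?P \<times> ?P"]) (use finP in auto)
    show "?\<psi> ` ?E \<subseteq> ?E'"
    proof (rule image_subsetI)
      fix pq assume "pq \<in> ?E"
      then obtain p q where pq: "pq = (p, q)" "p \<in> ?C" "q \<in> ?C" "[root_diff p = root_diff q] (mod r)" by auto
      obtain m1 m2 k1 k2 where pe: "p = (m1, m2, k1, k2)" by (rule prod_cases4)
      obtain m3 m4 k3 k4 where qe: "q = (m3, m4, k3, k4)" by (rule prod_cases4)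
      have cc: "g dvd k1" "g dvd k2" "g dvd k3" "g dvd k4"
      proof -
        have e: "common_content r k1 k2 = g" "common_content r k3 k4 = g"
          using pq(2,3) by (simp_all add: pe qe content_pairs_def)
        show "g dvd k1" "g dvd k2" unfolding e(1)[symmetric] by (rule common_content_props(3,4)[OF r])+
        show "g dvd k3" "g dvd k4" unfolding e(2)[symmetric] by (rule common_content_props(3,4)[OF r])+
      qed
      then obtain l1 l2 l3 l4 where l: "k1 = g * l1" "k2 = g * l2" "k3 = g * l3" "k4 = g * l4" by (elim dvdE)
      have "r dvd (k1 - k2) - (k3 - k4)" using pq(4) by (simp add: pe qe root_diff_def cong_iff_dvd_diff)
      then have "g * (g * s) dvd g * ((l1 - l2) - (l3 - l4))" by (simp add: l s power2_eq_square algebra_simps)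
      then have "g * s dvd (l1 - l2) - (l3 - l4)" using g0 by simp
      then have "s dvd (l1 - l2) - (l3 - l4)" by (rule dvd_mult_right)
      then have "[l1 - l2 = l3 - l4] (mod s)" by (simp add: cong_iff_dvd_diff)
      then have "[l1 mod s - l2 mod s = l3 mod s - l4 mod s] (mod s)" by (simp add: unique_euclidean_semiring_class.cong_def mod_simps)
      then have "[root_diff (divide_content r g p) = root_diff (divide_content r g q)] (mod s)"
        using g0 by (simp add: pe qe divide_content_def root_diff_def rs l)
      then show "?\<psi> pq \<in> ?E'"
        using divide_content_mem(1)[OF r j pq(2)] divide_content_mem(1)[OF r j pq(3)] by (simp add: pq(1) rs)
    qed
    fix uv :: "(int \<times> int \<times> int \<times> int) \<times> (int \<times> int \<times> int \<times> int)"
    let ?Fib = "\<lambda>u. {p \<in> ?C. divide_content r g p = u}"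
    have "card {pq \<in> ?E. ?\<psi> pq = uv} \<le> card (?Fib (fst uv) \<times> ?Fib (snd uv))"
      using finC by (intro card_mono finite_cartesian_product) auto
    then have "real (card {pq \<in> ?E. ?\<psi> pq = uv}) \<le> real (card (?Fib (fst uv))) * real (card (?Fib (snd uv)))"
      by (simp only: card_cartesian_product of_nat_mult[symmetric] of_nat_le_iff)
    also have "\<dots> \<le> (real_of_int g)\<^sup>2 * (real_of_int g)\<^sup>2"
      by (intro mult_mono card_divide_content_fiber_le[OF r j g0 gr]) auto
    finally show "real (card {pq \<in> ?E. ?\<psi> pq = uv}) \<le> (real_of_int g)\<^sup>2 * (real_of_int g)\<^sup>2" .
  qed
  moreover have "real (card ?E') \<le> 5373952 * Q ^ 11 * ((H / g\<^sup>2) * (M / g\<^sup>2) * (1 + (H / g\<^sup>2)\<^sup>2 * (M / g\<^sup>2) / s))"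
  proof (rule primitive_energy_le[OF s0 _ gH])
    show "coprime s j" using j s by (simp add: coprime_mult_left_iff)
    show "H / g\<^sup>2 \<le> M / g\<^sup>2" using H by (intro divide_right_mono) auto
    show "M / g\<^sup>2 \<le> s" using M G rG by (simp add: field_simps)
    show "real (ndiv n) \<le> Q \<and> recip_sum n \<le> Q" if "0 < n" "n \<le> s" for n using Q[of n] that sr by simp
  qed
  ultimately have "real (card ?E) \<le> 5373952 * Q ^ 11 * ((H / g\<^sup>2) * (M / g\<^sup>2) * (1 + (H / g\<^sup>2)\<^sup>2 * (M / g\<^sup>2) / s)) * ((real_of_int g)\<^sup>2 * (real_of_int g)\<^sup>2)"
    by (meson mult_right_mono order_trans zero_le_mult_iff zero_le_power2)
  also have "\<dots> = 5373952 * Q ^ 11 * (H * M * (1 + H\<^sup>2 * M / r / ((real_of_int g)\<^sup>2)\<^sup>2))"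
    using G s0 g0 by (simp add: rG field_simps power2_eq_square)
  also have "\<dots> \<le> 5373952 * Q ^ 11 * (H * M * (1 + H\<^sup>2 * M / r))"
  proof -
    have "1 \<le> real_of_int (g\<^sup>2)" using g2 by linarith
    then have "1 \<le> ((real_of_int g)\<^sup>2)\<^sup>2" using one_le_power[of "(real_of_int g)\<^sup>2" 2] by simp
    then have "H\<^sup>2 * M / r / ((real_of_int g)\<^sup>2)\<^sup>2 \<le> H\<^sup>2 * M / r / 1" using H r by (intro divide_left_mono) auto
    moreover have "Q \<ge> 0" by (rule order_trans[OF of_nat_0_le_iff[of "ndiv r"]]) (use Q[of r] r in simp)
    ultimately show ?thesis using H by (intro mult_left_mono add_left_mono) auto
  qed
  finally show ?thesis unfolding root_energy_def .
qed

text \<open>Each pair has one content, a divisor of \<open>r\<close>. Cauchy--Schwarz over the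
  contents bounds the energy by \<open>ndiv r\<close> times the sum of the energies of the content
  classes, hence the two further powers of \<open>Q\<close>.\<close>

lemma sqroot_pairs_energy_le:
  fixes r j :: int and H M Q :: real
  assumes r: "r > 0" and j: "coprime r j" and H: "1 \<le> H" "H \<le> M" and M: "M \<le> r"
    and Q: "\<And>n. 0 < n \<Longrightarrow> n \<le> r \<Longrightarrow> real (ndiv n) \<le> Q \<and> recip_sum n \<le> Q"
  shows "real (root_energy r (sqroot_pairs r j M H)) \<le> 5373952 * Q ^ 13 * (H * M * (1 + H\<^sup>2 * M / r))"
proof -
  let ?P = "sqroot_pairs r j M H" and ?G = "{g. 0 < g \<and> g dvd r}" and ?R = "{0..<r}"
  let ?C = "content_pairs r j M H" and ?B = "5373952 * Q ^ 11 * (H * M * (1 + H\<^sup>2 * M / r))"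
  define N where "N g y = real (card {p \<in> ?C g. root_diff p mod r = y})" for g y
  have finG: "finite ?G" using r by simp
  have finC: "finite (?C g)" for g by (rule finite_subset[of _ ?P]) (auto simp: content_pairs_def)
  have Q0: "Q \<ge> 0" by (rule order_trans[OF of_nat_0_le_iff[of "ndiv r"]]) (use Q[of r] r in simp)
  have B0: "?B \<ge> 0" using Q0 H r by simp
  have E: "(\<Sum>y\<in>?R. (N g y)\<^sup>2) = real (root_energy r (?C g))" for g
    unfolding N_def root_energy_eq_sum[OF r finC] by simp
  have split: "real (card {p \<in> ?P. root_diff p mod r = y}) = (\<Sum>g\<in>?G. N g y)" for y
  proof -
    let ?A = "{p \<in> ?P. root_diff p mod r = y}"
    let ?c = "\<lambda>p::int \<times> int \<times> int \<times> int. common_content r (fst (snd (snd p))) (snd (snd (snd p)))"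
    have "card ?A = (\<Sum>g\<in>?G. card {p \<in> ?A. ?c p = g})"
    proof (rule card_eq_sum_fibers)
      show "?c ` ?A \<subseteq> ?G"
      proof (rule image_subsetI)
        fix p
        have "(?c p)\<^sup>2 dvd r" by (rule common_content_props(2)[OF r])
        then have "?c p dvd r" by (simp add: power2_eq_square dvd_mult_left)
        then show "?c p \<in> ?G" using common_content_props(1)[OF r] by simp
      qed
    qed (use finG in simp_all)
    moreover have "{p \<in> ?A. ?c p = g} = {p \<in> ?C g. root_diff p mod r = y}" for g
      by (auto simp: content_pairs_def)
    ultimately show ?thesis by (simp add: N_def)
  qed
  have "real (root_energy r ?P) = (\<Sum>y\<in>?R. (\<Sum>g\<in>?G. N g y)\<^sup>2)"
    by (simp add: root_energy_eq_sum[OF r] split)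
  also have "\<dots> \<le> (\<Sum>y\<in>?R. (\<Sum>g\<in>?G. (N g y)\<^sup>2) * card ?G)"
    by (intro sum_mono sum_squared_le_sum_of_squares)
  also have "\<dots> = card ?G * (\<Sum>g\<in>?G. \<Sum>y\<in>?R. (N g y)\<^sup>2)"
    by (subst sum.swap) (simp add: sum_distrib_left mult.commute)
  also have "\<dots> \<le> card ?G * (\<Sum>g\<in>?G. ?B)"
    unfolding E by (intro mult_left_mono sum_mono content_energy_le assms) auto
  also have "\<dots> = (real (ndiv r))\<^sup>2 * ?B" by (simp add: ndiv_def power2_eq_square)
  also have "\<dots> \<le> Q\<^sup>2 * ?B" using Q[of r] r B0 by (intro mult_right_mono power_mono) auto
  also have "\<dots> = 5373952 * Q ^ 13 * (H * M * (1 + H\<^sup>2 * M / r))" by (simp add: power_numeral_reduce mult_ac)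
  finally show ?thesis .
qed

text \<open>The count is a correlation of \<open>N\<close> with a translate of itself. The
  inequality between a product and the mean of the squares, with invariance of the sum over residues
  under translation, makes the shift 0 the worst case.\<close>

lemma card_shifted_root_diff_le:
  assumes r: "r > 0" and fin: "finite A"
  shows "card {(p, q). p \<in> A \<and> q \<in> A \<and> [root_diff p = root_diff q + c] (mod r)} \<le> root_energy r A"
proof -
  let ?E = "{(p, q). p \<in> A \<and> q \<in> A \<and> [root_diff p = root_diff q + c] (mod r)}" and ?R = "{0..<r}"
  define N where "N y = card {p \<in> A. root_diff p mod r = y}" for y
  have finE: "finite ?E" by (rule finite_subset[of _ "A \<times> A"]) (use fin in auto)
  have iff: "[u = v + c] (mod r) \<longleftrightarrow> v mod r = (u mod r - c) mod r" for u v
  proof -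
    have "[u = v + c] (mod r) \<longleftrightarrow> [v = u - c] (mod r)"
      by (simp add: cong_iff_dvd_diff dvd_diff_commute algebra_simps)
    then show ?thesis by (simp add: unique_euclidean_semiring_class.cong_def mod_simps)
  qed
  have "card ?E = (\<Sum>y\<in>?R. card {pq \<in> ?E. root_diff (fst pq) mod r = y})"
    by (rule card_eq_sum_fibers[OF finE]) (use r in auto)
  also have "\<dots> = (\<Sum>y\<in>?R. N y * N ((y - c) mod r))"
  proof (rule sum.cong[OF refl])
    fix y
    have "{pq \<in> ?E. root_diff (fst pq) mod r = y}
        = {p \<in> A. root_diff p mod r = y} \<times> {q \<in> A. root_diff q mod r = (y - c) mod r}"
      using iff by auto
    then show "card {pq \<in> ?E. root_diff (fst pq) mod r = y} = N y * N ((y - c) mod r)"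
      by (simp add: card_cartesian_product N_def)
  qed
  finally have "2 * card ?E = (\<Sum>y\<in>?R. 2 * (N y * N ((y - c) mod r)))" by (simp add: sum_distrib_left)
  also have "\<dots> \<le> (\<Sum>y\<in>?R. (N y)\<^sup>2 + (N ((y - c) mod r))\<^sup>2)"
  proof (rule sum_mono)
    fix y
    have "2 * real (N y) * real (N ((y - c) mod r)) \<le> (real (N y))\<^sup>2 + (real (N ((y - c) mod r)))\<^sup>2"
      by (rule sum_squares_bound)
    then have "real (2 * (N y * N ((y - c) mod r))) \<le> real ((N y)\<^sup>2 + (N ((y - c) mod r))\<^sup>2)" by simp
    then show "2 * (N y * N ((y - c) mod r)) \<le> (N y)\<^sup>2 + (N ((y - c) mod r))\<^sup>2" by (simp only: of_nat_le_iff)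
  qed
  also have "\<dots> = (\<Sum>y\<in>?R. (N y)\<^sup>2) + (\<Sum>y\<in>?R. (N ((y - c) mod r))\<^sup>2)" by (rule sum.distrib)
  also have "(\<Sum>y\<in>?R. (N ((y - c) mod r))\<^sup>2) = (\<Sum>y\<in>?R. (N y)\<^sup>2)"
    by (rule sum.reindex_bij_witness[of _ "\<lambda>y. (y + c) mod r" "\<lambda>y. (y - c) mod r"]) (use r in \<open>auto simp: mod_simps\<close>)
  finally show ?thesis unfolding root_energy_eq_sum[OF r fin] N_def by simp
qed

section \<open>From tuples to pairs of neighbouring entries\<close>

lemma mod_sqrts_eq: "mod_sqrts r s = sqroots (int r) s"
  by (simp add: mod_sqrts_def sqroots_def cong_iff_dvd_diff)

definition nth_pair :: "nat \<Rightarrow> (nat \<Rightarrow> int) \<times> (nat \<Rightarrow> int) \<Rightarrow> int \<times> int \<times> int \<times> int" where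
  "nth_pair i = (\<lambda>(m, k). (m i, m (i + 1), k i, k (i + 1)))"

lemma nth_pair_mem:
  assumes "(m, k) \<in> sqrt_tuples n r j M" "1 \<le> i" "i + 1 \<le> n" "near_distinct H (m i) (m (i + 1))"
  shows "nth_pair i (m, k) \<in> sqroot_pairs (int r) (int j) M H"
proof -
  have "m l \<in> {1..\<lfloor>M\<rfloor>} \<and> k l \<in> sqroots (int r) (int j * m l)" if "l \<in> {1..n}" for l
  proof -
    have "m l \<in> {a. 1 \<le> a \<and> real_of_int a \<le> M}" using assms(1) that by (auto simp: sqrt_tuples_def)
    moreover have "k l \<in> mod_sqrts r (int j * m l)" using assms(1) that by (auto simp: sqrt_tuples_def)
    ultimately show ?thesis by (simp add: mod_sqrts_eq le_floor_iff)
  qed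
  from this[of i] this[of "i + 1"] assms(2-4) show ?thesis by (simp add: nth_pair_def sqroot_pairs_def)
qed

lemma sqrt_tuples_ext:
  assumes "x \<in> sqrt_tuples n r j M" "y \<in> sqrt_tuples n r j M"
    and "\<And>i. i \<in> {1..n} \<Longrightarrow> fst x i = fst y i \<and> snd x i = snd y i"
  shows "x = y"
proof (rule prod_eqI)
  show "fst x = fst y" using assms by (intro PiE_ext[of _ "{1..n}" "\<lambda>_. {a. 1 \<le> a \<and> real_of_int a \<le> M}"]) (auto simp: sqrt_tuples_def)
  have "snd x \<in> extensional {1..n}" "snd y \<in> extensional {1..n}"
    using assms(1,2) by (auto simp: sqrt_tuples_def PiE_def)
  then show "snd x = snd y" using assms(3) by (auto intro: extensionalityI)
qed

lemma E2_le_root_energy: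
  assumes "r > 0"
  shows "E2 r j M H \<le> root_energy (int r) (sqroot_pairs (int r) (int j) M H)"
proof -
  let ?P = "sqroot_pairs (int r) (int j) M H"
  let ?X = "{(m, k) \<in> sqrt_tuples 4 r j M. (\<forall>i \<in> {1, 3}. near_distinct H (m i) (m (i + 1))) \<and> [k 1 - k 2 = k 3 - k 4] (mod int r)}"
  let ?f = "\<lambda>x. (nth_pair 1 x, nth_pair 3 x)"
  have "inj_on ?f ?X"
  proof (rule inj_onI)
    fix x y assume x: "x \<in> ?X" and y: "y \<in> ?X" and e: "?f x = ?f y"
    show "x = y"
    proof (rule sqrt_tuples_ext)
      show "x \<in> sqrt_tuples 4 r j M" "y \<in> sqrt_tuples 4 r j M" using x y by auto
      fix i :: nat assume "i \<in> {1..4}"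
      then have "i = 1 \<or> i = 2 \<or> i = 3 \<or> i = 4" by auto
      then show "fst x i = fst y i \<and> snd x i = snd y i"
        using e by (auto simp: nth_pair_def case_prod_unfold numeral_eq_Suc)
    qed
  qed
  moreover have "?f ` ?X \<subseteq> {(p, q). p \<in> ?P \<and> q \<in> ?P \<and> [root_diff p = root_diff q] (mod int r)}"
  proof (rule image_subsetI)
    fix x assume x: "x \<in> ?X"
    obtain m k where xe: "x = (m, k)" by fastforce
    have t: "(m, k) \<in> sqrt_tuples 4 r j M" "near_distinct H (m 1) (m (1 + 1))" "near_distinct H (m 3) (m (3 + 1))"
      "[k 1 - k 2 = k 3 - k 4] (mod int r)" using x by (auto simp: xe)
    have "[root_diff (nth_pair 1 x) = root_diff (nth_pair 3 x)] (mod int r)"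
      using t(4) by (simp add: xe nth_pair_def root_diff_def numeral_eq_Suc)
    moreover have "nth_pair 1 x \<in> ?P" unfolding xe by (rule nth_pair_mem[OF t(1) _ _ t(2)]) simp_all
    moreover have "nth_pair 3 x \<in> ?P" unfolding xe by (rule nth_pair_mem[OF t(1) _ _ t(3)]) simp_all
    ultimately show "?f x \<in> {(p, q). p \<in> ?P \<and> q \<in> ?P \<and> [root_diff p = root_diff q] (mod int r)}" by simp
  qed
  moreover have "finite {(p, q). p \<in> ?P \<and> q \<in> ?P \<and> [root_diff p = root_diff q] (mod int r)}"
    by (rule finite_subset[of _ "?P \<times> ?P"]) auto
  ultimately show ?thesis unfolding E2_def root_energy_def by (rule card_inj_on_le)
qed

text \<open>With the second and fourth pairs fixed, the first and third satisfy a congruence shifted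
  by a constant, so each of the \<open>(card ?P)\<^sup>2\<close> choices leaves at most the
  energy.\<close>

lemma E4_le_root_energy:
  assumes r: "r > 0"
  shows "E4 r j M H \<le> (card (sqroot_pairs (int r) (int j) M H))\<^sup>2 * root_energy (int r) (sqroot_pairs (int r) (int j) M H)"
proof -
  let ?P = "sqroot_pairs (int r) (int j) M H"
  let ?X = "{(m, k) \<in> sqrt_tuples 8 r j M. (\<forall>i \<in> {1, 3, 5, 7}. near_distinct H (m i) (m (i + 1))) \<and>
     [k 1 - k 2 + k 3 - k 4 = k 5 - k 6 + k 7 - k 8] (mod int r)}"
  let ?f = "\<lambda>x. ((nth_pair 3 x, nth_pair 7 x), (nth_pair 1 x, nth_pair 5 x))"
  let ?S = "\<lambda>c. {(p, q). p \<in> ?P \<and> q \<in> ?P \<and> [root_diff p = root_diff q + c] (mod int r)}"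
  let ?T = "SIGMA pq:?P \<times> ?P. ?S (root_diff (snd pq) - root_diff (fst pq))"
  have finS: "finite (?S c)" for c by (rule finite_subset[of _ "?P \<times> ?P"]) auto
  have "inj_on ?f ?X"
  proof (rule inj_onI)
    fix x y assume x: "x \<in> ?X" and y: "y \<in> ?X" and e: "?f x = ?f y"
    show "x = y"
    proof (rule sqrt_tuples_ext)
      show "x \<in> sqrt_tuples 8 r j M" "y \<in> sqrt_tuples 8 r j M" using x y by auto
      fix i :: nat assume "i \<in> {1..8}"
      then have "i = 1 \<or> i = 2 \<or> i = 3 \<or> i = 4 \<or> i = 5 \<or> i = 6 \<or> i = 7 \<or> i = 8" by auto
      then show "fst x i = fst y i \<and> snd x i = snd y i"
        using e by (auto simp: nth_pair_def case_prod_unfold numeral_eq_Suc)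
    qed
  qed
  moreover have "?f ` ?X \<subseteq> ?T"
  proof (rule image_subsetI)
    fix x assume x: "x \<in> ?X"
    obtain m k where xe: "x = (m, k)" by fastforce
    have t: "(m, k) \<in> sqrt_tuples 8 r j M" "near_distinct H (m 1) (m (1 + 1))" "near_distinct H (m 3) (m (3 + 1))"
      "near_distinct H (m 5) (m (5 + 1))" "near_distinct H (m 7) (m (7 + 1))"
      and c: "[k 1 - k 2 + k 3 - k 4 = k 5 - k 6 + k 7 - k 8] (mod int r)" using x by (auto simp: xe)
    have d: "root_diff (nth_pair 1 x) = k 1 - k 2" "root_diff (nth_pair 3 x) = k 3 - k 4"
      "root_diff (nth_pair 5 x) = k 5 - k 6" "root_diff (nth_pair 7 x) = k 7 - k 8"
      by (simp_all add: xe nth_pair_def root_diff_def numeral_eq_Suc)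
    have "[root_diff (nth_pair 1 x) = root_diff (nth_pair 5 x) + (root_diff (nth_pair 7 x) - root_diff (nth_pair 3 x))] (mod int r)"
      using c unfolding d cong_iff_dvd_diff by (simp add: algebra_simps)
    moreover have "nth_pair 1 x \<in> ?P" unfolding xe by (rule nth_pair_mem[OF t(1) _ _ t(2)]) simp_all
    moreover have "nth_pair 3 x \<in> ?P" unfolding xe by (rule nth_pair_mem[OF t(1) _ _ t(3)]) simp_all
    moreover have "nth_pair 5 x \<in> ?P" unfolding xe by (rule nth_pair_mem[OF t(1) _ _ t(4)]) simp_all
    moreover have "nth_pair 7 x \<in> ?P" unfolding xe by (rule nth_pair_mem[OF t(1) _ _ t(5)]) simp_all
    ultimately show "?f x \<in> ?T" by simp
  qed
  moreover have "finite ?T" using finS by (intro finite_SigmaI) auto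
  ultimately have "E4 r j M H \<le> card ?T" unfolding E4_def by (rule card_inj_on_le)
  also have "\<dots> = (\<Sum>pq\<in>?P \<times> ?P. card (?S (root_diff (snd pq) - root_diff (fst pq))))"
    using finS by (intro card_SigmaI) auto
  also have "\<dots> \<le> (\<Sum>pq\<in>?P \<times> ?P. root_energy (int r) ?P)"
    using r by (intro sum_mono card_shifted_root_diff_le) auto
  finally show ?thesis by (simp add: card_cartesian_product power2_eq_square)
qed

section \<open>Absorbing the logarithms and assembling the bounds\<close>

lemma recip_sum_eq_harm: "recip_sum (int n) = harm n"
  unfolding recip_sum_def harm_def
  by (rule sum.reindex_bij_witness[of _ int nat]) (auto simp: inverse_eq_divide)

text \<open>The harmonic number exceeds the logarithm by at most 1, since that difference decreases
  from its value 1 at \<open>n = 1\<close>. The logarithm is absorbed by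
  \<open>ln t \<le> t - 1\<close> at \<open>t = n powr \<delta>\<close>.\<close>

lemma recip_sum_bound:
  fixes \<delta> :: real
  assumes "\<delta> > 0" "n > 0"
  shows "recip_sum n \<le> (1 + 1 / \<delta>) * real_of_int n powr \<delta>"
proof -
  obtain l where l: "n = int (Suc l)" using assms(2) by (metis zero_less_imp_eq_int Suc_pred)
  have "harm (Suc l) - ln (real (Suc l)) \<le> harm (Suc 0) - ln (real (Suc 0))"
    using decseqD[OF decseq_harm_diff_ln, of 0 l] by simp
  then have 1: "recip_sum n \<le> 1 + ln n" unfolding l recip_sum_eq_harm by (simp add: harm_expand)
  have 2: "1 \<le> real_of_int n powr \<delta>" using assms by (intro ge_one_powr_ge_zero) auto
  have "\<delta> * ln n \<le> real_of_int n powr \<delta> - 1"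
    using ln_le_minus_one[of "real_of_int n powr \<delta>"] assms by (simp add: ln_powr)
  then have "ln n \<le> real_of_int n powr \<delta> / \<delta>" using assms by (simp add: field_simps)
  then show ?thesis using 1 2 by (simp add: algebra_simps)
qed

theorem theorem1p5:
  fixes \<epsilon> :: real
  assumes "\<epsilon> > 0"
  shows "(\<exists>C::real. \<forall>(r::nat) (j::nat) (H::real) (M::real).
            1 \<le> r \<and> 1 \<le> j \<and> coprime r j \<and> 1 \<le> H \<and> H \<le> M \<and> M \<le> real r \<longrightarrow>
            real (E2 r j M H) \<le> C * ((H ^ 3 * M ^ 2 / real r + H * M) * real r powr \<epsilon>)) \<and>
         (\<exists>C::real. \<forall>(r::nat) (j::nat) (H::real) (M::real).
            1 \<le> r \<and> 1 \<le> j \<and> coprime r j \<and> 1 \<le> H \<and> H \<le> M \<and> M \<le> real r \<longrightarrow>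
            real (E4 r j M H) \<le>
              C * (H ^ 2 * M ^ 2 * (H ^ 3 * M ^ 2 / real r + H * M) * real r powr \<epsilon>))"
proof -
  \<comment> \<open>The exponent 19 is 13 from the energy plus 6 from the square of the pair count,
    which carries \<open>Q ^ 3\<close>.\<close>
  define \<delta> where "\<delta> = \<epsilon> / 19"
  have \<delta>: "\<delta> > 0" using assms by (simp add: \<delta>_def)
  obtain C0 where C0: "C0 \<ge> 1" "\<And>n. n > 0 \<Longrightarrow> real (ndiv n) \<le> C0 * real_of_int n powr \<delta>"
    using ndiv_bound[OF \<delta>] by blast
  define C where "C = C0 + (1 + 1 / \<delta>)"
  have C1: "C \<ge> 1" using C0 \<delta> by (simp add: C_def add_increasing2)
  have main: "real (E2 r j M H) \<le> 5373952 * C ^ 19 * ((H ^ 3 * M ^ 2 / real r + H * M) * real r powr \<epsilon>) \<and>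
      real (E4 r j M H) \<le> 64 * 5373952 * C ^ 19 * (H ^ 2 * M ^ 2 * (H ^ 3 * M ^ 2 / real r + H * M) * real r powr \<epsilon>)"
    if h: "1 \<le> r" "coprime r j" "1 \<le> H" "H \<le> M" "M \<le> real r" for r j :: nat and H M :: real
  proof -
    define Q where "Q = C * real r powr \<delta>"
    have r0: "int r > 0" and cj: "coprime (int r) (int j)" using h by simp_all
    have rp: "real r powr \<delta> \<ge> 1" using h \<delta> by (intro ge_one_powr_ge_zero) auto
    have Q1: "Q \<ge> 1" using C1 rp by (simp add: Q_def mult_ge1_I)
    have Q: "real (ndiv n) \<le> Q \<and> recip_sum n \<le> Q" if "0 < n" "n \<le> int r" for n
    proof -
      have "real_of_int n powr \<delta> \<le> real r powr \<delta>" using that \<delta> by (intro powr_mono2) auto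
      moreover have "C0 \<le> C" "1 + 1 / \<delta> \<le> C" using C0(1) \<delta> by (simp_all add: C_def)
      ultimately have "C0 * real_of_int n powr \<delta> \<le> Q" "(1 + 1 / \<delta>) * real_of_int n powr \<delta> \<le> Q"
        using C1 C0(1) \<delta> unfolding Q_def by (auto intro!: mult_mono)
      then show ?thesis using C0(2)[OF that(1)] recip_sum_bound[OF \<delta> that(1)] by linarith
    qed
    have Q19: "Q ^ 19 = C ^ 19 * real r powr \<epsilon>"
      using h by (simp add: Q_def power_mult_distrib \<delta>_def powr_realpow[symmetric] powr_powr)
    let ?P = "sqroot_pairs (int r) (int j) M H" and ?B = "H ^ 3 * M ^ 2 / real r + H * M"
    have B: "H * M * (1 + H\<^sup>2 * M / real r) = ?B" by (simp add: algebra_simps power2_eq_square power3_eq_cube)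
    have B0: "?B \<ge> 0" using h by simp
    have en: "real (root_energy (int r) ?P) \<le> 5373952 * Q ^ 13 * ?B"
      using sqroot_pairs_energy_le[OF r0 cj h(3,4) _ Q] h(5) by (simp add: B)
    have "real (E2 r j M H) \<le> real (root_energy (int r) ?P)"
      unfolding of_nat_le_iff using h by (intro E2_le_root_energy) simp
    also have "\<dots> \<le> 5373952 * Q ^ 13 * ?B" by (rule en)
    \<comment> \<open>Raising the exponent from 13 to 19 lets both estimates use the same
      \<open>\<delta>\<close>.\<close>
    also have "\<dots> \<le> 5373952 * Q ^ 19 * ?B"
      using Q1 B0 by (intro mult_right_mono mult_left_mono power_increasing) auto
    finally have e2: "real (E2 r j M H) \<le> 5373952 * C ^ 19 * (?B * real r powr \<epsilon>)" by (simp add: Q19 mult_ac)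
    have "real (card ?P) \<le> 8 * H * M * (real (ndiv (int r))) ^ 3"
      using h by (intro card_sqroot_pairs_le[OF r0 cj]) auto
    also have "\<dots> \<le> 8 * H * M * Q ^ 3" using Q[of "int r"] r0 h by (intro mult_left_mono power_mono) auto
    finally have "(real (card ?P))\<^sup>2 \<le> (8 * H * M * Q ^ 3)\<^sup>2" by (intro power_mono) auto
    moreover have "real (E4 r j M H) \<le> real ((card ?P)\<^sup>2 * root_energy (int r) ?P)"
      unfolding of_nat_le_iff using h by (intro E4_le_root_energy) simp
    ultimately have "real (E4 r j M H) \<le> (8 * H * M * Q ^ 3)\<^sup>2 * (5373952 * Q ^ 13 * ?B)"
      using en by (smt (verit) mult_mono of_nat_0_le_iff of_nat_mult of_nat_power zero_le_power2)
    also have "\<dots> = 64 * 5373952 * Q ^ 19 * (H ^ 2 * M ^ 2 * ?B)"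
      by (simp add: power_mult_distrib power_mult[symmetric] mult_ac flip: power_add)
    finally have "real (E4 r j M H) \<le> 64 * 5373952 * C ^ 19 * (H ^ 2 * M ^ 2 * ?B * real r powr \<epsilon>)"
      by (simp only: Q19 mult_ac)
    then show ?thesis using e2 by blast
  qed
  then show ?thesis by blast
qed

end
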